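(* For all $k \geq 1$ and all $n > k$, the group $\mathrm{IA}_n(k)$ is not generated by elements supported on splittings of $F_n$ of rank less than $k$.
   Context: $F_n$ is the free group of rank $n$. For a group $G$, $\gamma_1(G)=G$ and $\gamma_{k+1}(G)=[\gamma_k(G),G]$. $\mathrm{IA}_n(k)$ is the kernel of the action of $\mathrm{Aut}(F_n)$ on $F_n/\gamma_{k+1}(F_n)$. A splitting of $F_n$ is a pair of subgroups $A,B<F_n$ with $F_n=A\ast B$; its rank is the rank of $A$. An automorphism $\varphi$ is supported on the splitting $A\ast B$ if $\varphi(A)=A$ and $\varphi|_B=\mathrm{id}$. *)

theory Defs
  imports "HOL-Algebra.Algebra"
begin

type_synonym letter = "nat \<times> bool"   \<comment> \<open>(i, True) = x_i, (i, False) = x_i^{-1}\<close>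

definition inv_letter :: "letter \<Rightarrow> letter" where
  "inv_letter l = (fst l, \<not> snd l)"

definition reduced :: "letter list \<Rightarrow> bool" where
  "reduced w \<longleftrightarrow> (\<forall>i. Suc i < length w \<longrightarrow> w ! Suc i \<noteq> inv_letter (w ! i))"

fun red :: "letter list \<Rightarrow> letter list" where
  "red [] = []"
| "red (x # xs) = (case red xs of
                      [] \<Rightarrow> [x]
                    | y # ys \<Rightarrow> (if y = inv_letter x then ys else x # y # ys))"

definition free_group :: "nat \<Rightarrow> letter list monoid" where
  "free_group n = \<lparr> carrier = {w. reduced w \<and> (\<forall>l \<in> set w. fst l < n)},
                    monoid.mult = (\<lambda>u v. red (u @ v)),
                    one = [] \<rparr>"

definition commutator :: "('a, 'b) monoid_scheme \<Rightarrow> 'a \<Rightarrow> 'a \<Rightarrow> 'a" where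
  "commutator G x y = x \<otimes>\<^bsub>G\<^esub> y \<otimes>\<^bsub>G\<^esub> inv\<^bsub>G\<^esub> x \<otimes>\<^bsub>G\<^esub> inv\<^bsub>G\<^esub> y"

text \<open>lcs G k = gamma_(k+1)(G): lcs G 0 = G, lcs G (k+1) = [lcs G k, G].\<close>
primrec lcs :: "('a, 'b) monoid_scheme \<Rightarrow> nat \<Rightarrow> 'a set" where
  "lcs G 0 = carrier G"
| "lcs G (Suc k) = generate G {commutator G x g | x g. x \<in> lcs G k \<and> g \<in> carrier G}"

definition gamma :: "('a, 'b) monoid_scheme \<Rightarrow> nat \<Rightarrow> 'a set" where
  "gamma G k = lcs G (k - 1)"

text \<open>Kernel of the action of Aut(F_n) on F_n / gamma_(k+1)(F_n).\<close>
definition IA :: "nat \<Rightarrow> nat \<Rightarrow> (letter list \<Rightarrow> letter list) set" where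
  "IA n k = {\<phi> \<in> auto (free_group n).
     \<forall>x \<in> carrier (free_group n).
        \<phi> x \<otimes>\<^bsub>free_group n\<^esub> inv\<^bsub>free_group n\<^esub> x \<in> gamma (free_group n) (k + 1)}"

definition listprod :: "('a, 'b) monoid_scheme \<Rightarrow> 'a list \<Rightarrow> 'a" where
  "listprod G gs = foldr (\<lambda>g acc. g \<otimes>\<^bsub>G\<^esub> acc) gs \<one>\<^bsub>G\<^esub>"

text \<open>G is the internal free product A * B: A, B are subgroups generating G and
  no nonempty alternating word of nontrivial elements of A and B is trivial
  (side True = factor A, side False = factor B).\<close>
definition free_splitting :: "('a, 'b) monoid_scheme \<Rightarrow> 'a set \<Rightarrow> 'a set \<Rightarrow> bool" where
  "free_splitting G A B \<longleftrightarrow>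
     subgroup A G \<and> subgroup B G \<and> generate G (A \<union> B) = carrier G \<and>
     (\<forall>ws :: (bool \<times> 'a) list.
        ws \<noteq> [] \<and>
        (\<forall>(s, g) \<in> set ws. g \<in> (if s then A else B) \<and> g \<noteq> \<one>\<^bsub>G\<^esub>) \<and>
        (\<forall>i. Suc i < length ws \<longrightarrow> fst (ws ! i) \<noteq> fst (ws ! Suc i))
        \<longrightarrow> listprod G (map snd ws) \<noteq> \<one>\<^bsub>G\<^esub>)"

definition subgroup_rank :: "('a, 'b) monoid_scheme \<Rightarrow> 'a set \<Rightarrow> nat" where
  "subgroup_rank G A = (LEAST r. \<exists>S. finite S \<and> card S = r \<and> S \<subseteq> A \<and> generate G S = A)"

definition supported_on :: "('a \<Rightarrow> 'a) \<Rightarrow> 'a set \<Rightarrow> 'a set \<Rightarrow> bool" where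
  "supported_on \<phi> A B \<longleftrightarrow> \<phi> ` A = A \<and> (\<forall>b \<in> B. \<phi> b = b)"

end

(* Compose the leading term gamma_(k+1) / gamma_(k+2) --> H^(k+1) (tensor power, H the abelianisation
   modulo 2) with the functional a (x) det, where det is the determinant form on the first k
   coordinates. The determinant dies on tensors from a subspace of dimension less than k. If phi in
   IA_n(k) is supported on A * B with rank A < k, then g |-> phi(g) g^-1 modulo gamma_(k+2) is
   additive, kills B, and by the retraction onto A sends A to tensors in the abelianisation of A;
   hence the functional annihilates it, and also everything generated by such automorphisms. On the
   other hand, as n > k, the automorphism multiplying x_k by the commutator
   [x_0, ..., x_(k-1), x_0] lies in IA_n(k) and has value 1 (for k = 1 one conjugates x_1 by x_0).
   Working modulo 2 makes the determinant a permanent and removes all signs. *)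

theory Submission
  imports Defs "HOL-Library.Z2"
begin

text \<open>The determinant has degree k and the leading term degree k + 1, so one extra form a is
  spent on the first tensor factor. The witness pays for it by repeating the generator x_0: this
  fills degree k + 1 while staying inside the free group on x_0, ..., x_(k-1), and that makes
  multiplying x_k by it invertible. For k = 1 the commutator [x_0, x_0] is trivial, hence the
  separate case.

  The obstacle is that for g in A the element phi(g) g^-1 is only known to lie in A and in
  gamma_(k+1)(F_n), while the vanishing of the determinant is a statement about commutators of
  elements of A. A retraction rho onto A bridges the gap, since it fixes A and carries ambient
  commutators to commutators in A. To make restriction to A a mere composition with rho,
  coefficients of the Magnus expansion are indexed by words of linear forms on the abelianisation
  instead of words of basis elements. Rank less than k then enters only through one nonzero form T,
  supported on the first k coordinates and vanishing on A.\<close>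

section \<open>Free groups\<close>

lemma inv_letter_inv_letter [simp]: "inv_letter (inv_letter l) = l"
  by (simp add: inv_letter_def)

lemma fst_inv_letter [simp]: "fst (inv_letter l) = fst l"
  by (simp add: inv_letter_def)

lemma reduced_Nil [simp]: "reduced []"
  by (simp add: reduced_def)

lemma reduced_Cons:
  "reduced (x # w) \<longleftrightarrow> reduced w \<and> (w = [] \<or> hd w \<noteq> inv_letter x)"
  by (cases w) (auto simp: reduced_def nth_Cons split: nat.splits)

lemma red_reduced: "reduced w \<Longrightarrow> red w = w"
  by (induction w) (auto simp: reduced_Cons split: list.splits)

lemma reduced_red [simp]: "reduced (red w)"
  by (induction w) (auto simp: reduced_Cons split: list.splits)

lemma red_red [simp]: "red (red w) = red w"
  by (simp add: red_reduced)

lemma set_red_subset: "set (red w) \<subseteq> set w"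
  by (induction w) (auto split: list.splits if_splits)

lemma red_Cons_cong: "red u = red v \<Longrightarrow> red (x # u) = red (x # v)"
  by simp

lemma red_append_cong: "red u = red v \<Longrightarrow> red (w @ u) = red (w @ v)"
  by (induction w) auto

lemma red_append_red_right [simp]: "red (u @ red v) = red (u @ v)"
  by (rule red_append_cong) simp

lemma red_cancel: "red (x # inv_letter x # w) = red w"
proof -
  have "reduced (red w)" by simp
  then show ?thesis
    by (cases "red w") (auto simp: reduced_Cons split: list.splits)
qed

text \<open>Together with \<open>red_append_red_right\<close> this yields associativity in
  \<open>free_group\<close>. A letter in front of \<open>red u\<close> either stays or cancels the
  head, and in the second case \<open>red_cancel\<close> removes the same pair from the longer
  word.\<close>

lemma red_append_red_left [simp]: "red (red u @ v) = red (u @ v)"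
proof (induction u)
  case (Cons x u)
  have *: "red (x # u @ v) = red (x # red u @ v)"
    using Cons by (intro red_Cons_cong) simp
  show ?case
  proof (cases "red u")
    case Nil
    then show ?thesis using * by simp
  next
    case (Cons y ys)
    show ?thesis
    proof (cases "y = inv_letter x")
      case True
      have "red (x # red u @ v) = red (ys @ v)"
        using True Cons red_cancel[of x "ys @ v"] by simp
      moreover have "red (x # u) = ys" using True Cons by simp
      ultimately show ?thesis using * by simp
    next
      case False
      then have "red (x # u) = x # red u" using Cons by simp
      then show ?thesis using * by simp
    qed
  qed
qed simp

definition inv_word :: "letter list \<Rightarrow> letter list" where
  "inv_word w = map inv_letter (rev w)"

lemma inv_word_inv_word [simp]: "inv_word (inv_word w) = w"
  by (simp add: inv_word_def rev_map comp_def)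

lemma red_inv_word_right: "red (w @ inv_word w) = []"
proof (induction w)
  case (Cons x w)
  have "red (x # w @ inv_word w @ [inv_letter x]) = red (x # inv_letter x # [])"
    using red_append_red_left[of "w @ inv_word w" "[inv_letter x]"] Cons
    by (intro red_Cons_cong) simp
  then show ?case by (simp only: red_cancel) (simp add: inv_word_def)
qed (simp add: inv_word_def)

lemma reduced_rev_iff: "reduced (rev w) \<longleftrightarrow> reduced w"
proof -
  have "reduced (rev w)" if "reduced w" for w
  proof (unfold reduced_def, intro allI impI)
    fix i assume i: "Suc i < length (rev w)"
    define j where "j = length w - Suc (Suc i)"
    have j: "Suc j < length w" using i by (simp add: j_def)
    have "rev w ! i = w ! Suc j" "rev w ! Suc i = w ! j"
      using i by (simp_all add: rev_nth j_def Suc_diff_Suc)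
    then show "rev w ! Suc i \<noteq> inv_letter (rev w ! i)"
      using that j by (metis inv_letter_inv_letter reduced_def)
  qed
  from this[of w] this[of "rev w"] show ?thesis by auto
qed

lemma reduced_inv_word: "reduced w \<Longrightarrow> reduced (inv_word w)"
proof -
  assume "reduced w"
  then have "reduced (rev w)" by (simp add: reduced_rev_iff)
  then show ?thesis
    unfolding inv_word_def reduced_def
    by (simp add: inv_letter_def prod_eq_iff)
qed

lemma carrier_free_group:
  "w \<in> carrier (free_group n) \<longleftrightarrow> reduced w \<and> (\<forall>l\<in>set w. fst l < n)"
  by (simp add: free_group_def)

lemma mult_free_group [simp]: "u \<otimes>\<^bsub>free_group n\<^esub> v = red (u @ v)"
  and one_free_group [simp]: "\<one>\<^bsub>free_group n\<^esub> = []"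
  by (simp_all add: free_group_def)

lemma inv_word_closed:
  "w \<in> carrier (free_group n) \<Longrightarrow> inv_word w \<in> carrier (free_group n)"
  by (simp add: carrier_free_group reduced_inv_word) (simp add: inv_word_def)

lemma group_free_group: "group (free_group n)"
proof (rule groupI)
  fix x y assume "x \<in> carrier (free_group n)" "y \<in> carrier (free_group n)"
  then show "x \<otimes>\<^bsub>free_group n\<^esub> y \<in> carrier (free_group n)"
    using set_red_subset[of "x @ y"] by (auto simp: carrier_free_group)
next
  fix x assume x: "x \<in> carrier (free_group n)"
  then show "\<one>\<^bsub>free_group n\<^esub> \<otimes>\<^bsub>free_group n\<^esub> x = x"
    by (simp add: carrier_free_group red_reduced)
  show "\<exists>y\<in>carrier (free_group n). y \<otimes>\<^bsub>free_group n\<^esub> x = \<one>\<^bsub>free_group n\<^esub>"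
    using inv_word_closed[OF x] red_inv_word_right[of "inv_word x"] by auto
qed (auto simp: carrier_free_group)

lemma inv_free_group:
  assumes "w \<in> carrier (free_group n)"
  shows "inv\<^bsub>free_group n\<^esub> w = inv_word w"
proof -
  interpret F: group "free_group n" by (rule group_free_group)
  show ?thesis
    using assms inv_word_closed[OF assms] red_inv_word_right[of "inv_word w"]
    by (intro F.inv_equality) auto
qed

lemma subgroup_free_group:
  assumes "m \<le> n"
  shows "subgroup (carrier (free_group m)) (free_group n)"
proof -
  interpret M: group "free_group m" by (rule group_free_group)
  have sub: "carrier (free_group m) \<subseteq> carrier (free_group n)"
    using assms by (fastforce simp: carrier_free_group)
  show ?thesis
  proof (rule subgroup.intro)
    fix x y assume "x \<in> carrier (free_group m)" "y \<in> carrier (free_group m)"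
    then show "x \<otimes>\<^bsub>free_group n\<^esub> y \<in> carrier (free_group m)"
      using M.m_closed[of x y] by simp
  next
    fix x assume "x \<in> carrier (free_group m)"
    then show "inv\<^bsub>free_group n\<^esub> x \<in> carrier (free_group m)"
      using sub inv_word_closed[of x m] inv_free_group[of x n] by auto
  qed (use sub in \<open>auto simp: carrier_free_group\<close>)
qed

abbreviation gen :: "nat \<Rightarrow> letter list" where
  "gen i \<equiv> [(i, True)]"

lemma gen_in_carrier: "gen i \<in> carrier (free_group n) \<longleftrightarrow> i < n"
  by (simp add: carrier_free_group reduced_Cons)

lemma generate_gens: "generate (free_group n) (gen ` {..<n}) = carrier (free_group n)"
proof -
  interpret F: group "free_group n" by (rule group_free_group)
  let ?H = "generate (free_group n) (gen ` {..<n})"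
  have sub: "gen ` {..<n} \<subseteq> carrier (free_group n)" by (auto simp: gen_in_carrier)
  have letter: "[l] \<in> ?H" if "fst l < n" for l
  proof (cases "snd l")
    case True
    then show ?thesis using that by (cases l) (auto intro: generate.incl)
  next
    case False
    then have "[l] = inv\<^bsub>free_group n\<^esub> (gen (fst l))"
      using that by (cases l) (simp add: inv_free_group gen_in_carrier inv_word_def inv_letter_def)
    then show ?thesis using that by (auto intro: generate.inv)
  qed
  have "w \<in> ?H" if "w \<in> carrier (free_group n)" for w
    using that
  proof (induction w)
    case Nil
    then show ?case using generate.one[of "free_group n"] by simp
  next
    case (Cons l w)
    then have "w \<in> ?H" "[l] \<in> ?H" by (auto simp: carrier_free_group reduced_Cons intro: letter)
    then have "red ([l] @ w) \<in> ?H" using generate.eng[of "[l]" "free_group n" _ w] by simp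
    then show ?case using Cons.prems by (simp add: carrier_free_group red_reduced del: red.simps)
  qed
  then show ?thesis using F.generate_incl[OF sub] by auto
qed

text \<open>Used to verify identities between endomorphisms on generators only.\<close>

lemma free_group_subgroup_eq:
  assumes "subgroup H (free_group n)" "\<And>i. i < n \<Longrightarrow> gen i \<in> H"
  shows "H = carrier (free_group n)"
proof -
  interpret F: group "free_group n" by (rule group_free_group)
  show ?thesis
    using F.generate_subgroup_incl[of "gen ` {..<n}" H] assms subgroup.subset[OF assms(1)]
    by (auto simp: generate_gens)
qed

subsection \<open>Evaluation of words\<close>

lemma listprod_simps [simp]:
  "listprod G [] = \<one>\<^bsub>G\<^esub>" "listprod G (x # xs) = x \<otimes>\<^bsub>G\<^esub> listprod G xs"
  by (simp_all add: listprod_def)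

lemma (in monoid) listprod_closed [simp]:
  "set xs \<subseteq> carrier G \<Longrightarrow> listprod G xs \<in> carrier G"
  by (induction xs) auto

lemma (in monoid) listprod_append:
  "set xs \<subseteq> carrier G \<Longrightarrow> set ys \<subseteq> carrier G \<Longrightarrow>
     listprod G (xs @ ys) = listprod G xs \<otimes> listprod G ys"
  by (induction xs) (auto simp: m_assoc)

lemma (in monoid) listprod_map_red:
  assumes "\<And>l. l \<in> set w \<Longrightarrow> s l \<in> carrier G"
    and "\<And>l. l \<in> set w \<Longrightarrow> s l \<otimes> s (inv_letter l) = \<one>"
  shows "listprod G (map s (red w)) = listprod G (map s w)"
  using assms
proof (induction w)
  case (Cons x w)
  have IH: "listprod G (map s (red w)) = listprod G (map s w)" using Cons by simp
  have mem: "s l \<in> carrier G" if "l \<in> set (red w)" for l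
    using that set_red_subset[of w] Cons.prems(1)[of l] by auto
  show ?case
  proof (cases "\<exists>ys. red w = inv_letter x # ys")
    case True
    then obtain ys where ys: "red w = inv_letter x # ys" by auto
    have c: "s x \<in> carrier G" "s (inv_letter x) \<in> carrier G" "set (map s ys) \<subseteq> carrier G"
      using Cons.prems(1)[of x] mem ys by auto
    have "s x \<otimes> listprod G (map s w)
        = (s x \<otimes> s (inv_letter x)) \<otimes> listprod G (map s ys)"
      using IH ys c by (simp add: m_assoc flip: IH)
    also have "\<dots> = listprod G (map s ys)" using c Cons.prems(2)[of x] by simp
    finally show ?thesis using ys by simp
  next
    case False
    then have "red (x # w) = x # red w" by (cases "red w") auto
    then show ?thesis using IH by simp
  qed
qed simp

text \<open>The existence half of the universal property. The target is only a monoid because power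
  series need not be invertible; only the values on letters have to be.\<close>

lemma listprod_map_hom:
  assumes "monoid G" "\<And>l. fst l < n \<Longrightarrow> s l \<in> carrier G"
    and "\<And>l. fst l < n \<Longrightarrow> s l \<otimes>\<^bsub>G\<^esub> s (inv_letter l) = \<one>\<^bsub>G\<^esub>"
  shows "(\<lambda>w. listprod G (map s w)) \<in> hom (free_group n) G"
proof -
  interpret monoid G by fact
  show ?thesis
  proof (rule homI)
    fix x y assume "x \<in> carrier (free_group n)" "y \<in> carrier (free_group n)"
    then have xy: "fst l < n" if "l \<in> set x \<or> l \<in> set y" for l
      using that by (auto simp: carrier_free_group)
    have "listprod G (map s (red (x @ y))) = listprod G (map s (x @ y))"
      using xy assms(2,3) by (intro listprod_map_red) auto
    also have "\<dots> = listprod G (map s x) \<otimes>\<^bsub>G\<^esub> listprod G (map s y)"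
      unfolding map_append using xy assms(2) by (intro listprod_append) auto
    finally show "listprod G (map s (x \<otimes>\<^bsub>free_group n\<^esub> y))
       = listprod G (map s x) \<otimes>\<^bsub>G\<^esub> listprod G (map s y)" by simp
  next
    fix x assume "x \<in> carrier (free_group n)"
    then show "listprod G (map s x) \<in> carrier G"
      using assms(2) by (intro listprod_closed) (auto simp: carrier_free_group)
  qed
qed

lemma listprod_singletons: "listprod (free_group n) (map (\<lambda>l. [l]) w) = red w"
proof (induction w)
  case (Cons l w)
  then have "listprod (free_group n) (map (\<lambda>l. [l]) (l # w)) = red ([l] @ red w)" by simp
  then show ?case by (simp only: red_append_red_right) simp
qed simp

section \<open>Lower central series\<close>

declare lcs.simps(2) [simp del]

lemma (in group) commutator_closed [simp]:
  "x \<in> carrier G \<Longrightarrow> y \<in> carrier G \<Longrightarrow> commutator G x y \<in> carrier G"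
  by (simp add: commutator_def)

text \<open>An equation free of inverses: in power series it becomes C (Q P) = P Q, from which the
  low-degree coefficients of C can be read off.\<close>

lemma (in group) commutator_mult:
  assumes "x \<in> carrier G" "y \<in> carrier G"
  shows "commutator G x y \<otimes> (y \<otimes> x) = x \<otimes> y"
proof -
  have "inv y \<otimes> (y \<otimes> x) = x" using assms by (simp flip: m_assoc)
  then show ?thesis using assms by (simp add: commutator_def m_assoc)
qed

lemma (in group) conj_commutator:
  assumes "x \<in> carrier G" "y \<in> carrier G" "g \<in> carrier G"
  shows "g \<otimes> commutator G x y \<otimes> inv g
       = commutator G (g \<otimes> x \<otimes> inv g) (g \<otimes> y \<otimes> inv g)"
proof -
  have c: "inv g \<otimes> (g \<otimes> z) = z" if "z \<in> carrier G" for z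
    using that assms by (simp flip: m_assoc)
  show ?thesis using assms by (simp add: commutator_def m_assoc inv_mult_group c)
qed

lemma (in group) lcs_normal: "lcs G k \<lhd> G"
proof (induction k)
  case 0
  show ?case by (simp add: normal_invI subgroup_self)
next
  case (Suc k)
  interpret N: normal "lcs G k" G by (rule Suc)
  show ?case
    unfolding lcs.simps(2)
  proof (rule normal_generateI)
    fix h g assume h: "h \<in> {commutator G x g |x g. x \<in> lcs G k \<and> g \<in> carrier G}"
      and g: "g \<in> carrier G"
    then obtain x y where "x \<in> lcs G k" "y \<in> carrier G" "h = commutator G x y" by auto
    then show "g \<otimes> h \<otimes> inv g \<in> {commutator G x g |x g. x \<in> lcs G k \<and> g \<in> carrier G}"
      using g conj_commutator[of x y g] N.inv_op_closed2[of g x] N.mem_carrier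
      by (intro CollectI exI[of _ "g \<otimes> x \<otimes> inv g"] exI[of _ "g \<otimes> y \<otimes> inv g"]) auto
  qed (auto intro: N.mem_carrier)
qed

lemma (in group) lcs_subset: "lcs G k \<subseteq> carrier G"
  using lcs_normal normal_imp_subgroup subgroup.subset by blast

lemma (in group) lcs_closed: "x \<in> lcs G k \<Longrightarrow> x \<in> carrier G"
  using lcs_subset by blast

text \<open>Inverses occur only for commutators, and their case carries both the induction
  hypothesis and the membership in \<open>lcs G (Suc k)\<close>, so that facts about inverses inside
  the lower central series apply.\<close>

lemma (in group) lcs_Suc_induct [consumes 1, case_names one commutator inv_commutator mult]:
  assumes "w \<in> lcs G (Suc k)"
    and "P \<one>"
    and "\<And>x g. x \<in> lcs G k \<Longrightarrow> g \<in> carrier G \<Longrightarrow> P (commutator G x g)"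
    and "\<And>x g. x \<in> lcs G k \<Longrightarrow> g \<in> carrier G \<Longrightarrow> P (commutator G x g) \<Longrightarrow>
           commutator G x g \<in> lcs G (Suc k) \<Longrightarrow> P (inv (commutator G x g))"
    and "\<And>u v. u \<in> lcs G (Suc k) \<Longrightarrow> v \<in> lcs G (Suc k) \<Longrightarrow> P u \<Longrightarrow> P v \<Longrightarrow> P (u \<otimes> v)"
  shows "P w"
  using assms(1) unfolding lcs.simps(2)
proof (induction rule: generate.induct)
  case (inv h)
  then obtain x g where xg: "h = commutator G x g" "x \<in> lcs G k" "g \<in> carrier G" by auto
  have "h \<in> lcs G (Suc k)" unfolding lcs.simps(2) by (rule generate.incl) (rule inv)
  then show ?case using xg assms(3,4)[of x g] by simp
qed (use assms in \<open>auto simp: lcs.simps(2)\<close>)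

section \<open>Noncommutative power series\<close>

type_synonym ('c, 'r) series = "'c list \<Rightarrow> 'r"

definition conv :: "('c, 'r::comm_ring_1) series \<Rightarrow> ('c, 'r) series \<Rightarrow> ('c, 'r) series" where
  "conv P Q cs = (\<Sum>i\<le>length cs. P (take i cs) * Q (drop i cs))"

definition unit_series :: "('c, 'r::comm_ring_1) series" where
  "unit_series cs = of_bool (cs = [])"

definition series_monoid :: "('c, 'r::comm_ring_1) series monoid" where
  "series_monoid = \<lparr>carrier = UNIV, monoid.mult = conv, one = unit_series\<rparr>"

lemma series_monoid_simps [simp]:
  "carrier series_monoid = UNIV" "P \<otimes>\<^bsub>series_monoid\<^esub> Q = conv P Q"
  "\<one>\<^bsub>series_monoid\<^esub> = unit_series"
  by (simp_all add: series_monoid_def)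

lemma unit_series_simps [simp]: "unit_series [] = 1" "unit_series (c # cs) = 0"
  by (simp_all add: unit_series_def)

lemma conv_Nil [simp]: "conv P Q [] = P [] * Q []"
  by (simp add: conv_def)

lemma conv_Cons: "conv P Q (c # cs) = P [] * Q (c # cs) + conv (\<lambda>ds. P (c # ds)) Q cs"
  by (simp add: conv_def sum.atMost_Suc_shift del: sum.atMost_Suc)

lemma conv_add_left: "conv (\<lambda>ds. P ds + P' ds) Q cs = conv P Q cs + conv P' Q cs"
  by (simp add: conv_def sum.distrib distrib_right)

lemma conv_scale_left: "conv (\<lambda>ds. a * P ds) Q cs = a * conv P Q cs"
  by (simp add: conv_def sum_distrib_left mult.assoc)

text \<open>Both sides are expanded by splitting off the first variable; \<open>P\<close> is
  generalised because this replaces it by the shifted series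
  \<open>\<lambda>es. P (c # es)\<close>.\<close>

lemma conv_assoc: "conv (conv P Q) R cs = conv P (conv Q R) cs"
proof (induction cs arbitrary: P)
  case (Cons c cs)
  have "conv (conv P Q) R (c # cs)
      = P [] * Q [] * R (c # cs)
        + conv (\<lambda>ds. P [] * Q (c # ds) + conv (\<lambda>es. P (c # es)) Q ds) R cs"
    by (simp add: conv_Cons)
  also have "\<dots> = P [] * conv Q R (c # cs) + conv (\<lambda>es. P (c # es)) (conv Q R) cs"
    by (simp add: conv_add_left conv_scale_left Cons conv_Cons[of Q] distrib_left add.assoc mult.assoc)
  finally show ?case by (simp add: conv_Cons)
qed (simp add: mult.assoc)

lemma conv_unit_left [simp]: "conv unit_series P cs = P cs"
  by (cases cs) (simp_all add: conv_Cons, simp add: conv_def)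

lemma conv_unit_right [simp]: "conv P unit_series cs = P cs"
  by (induction cs arbitrary: P) (simp_all add: conv_Cons)

lemma monoid_series: "monoid series_monoid"
  by (rule monoidI) (auto simp: conv_assoc)

subsection \<open>The filtration of principal units\<close>

text \<open>Series of the form 1 + (terms of degree greater than \<open>j\<close>). The index
  matches \<open>lcs G j\<close>, which is gamma_(j+1) and whose leading degree is j + 1.\<close>

definition unit_mod :: "nat \<Rightarrow> ('c, 'r::comm_ring_1) series \<Rightarrow> bool" where
  "unit_mod j P \<longleftrightarrow> P [] = 1 \<and> (\<forall>cs. 0 < length cs \<and> length cs \<le> j \<longrightarrow> P cs = 0)"

lemma unit_mod_eq_0:
  "unit_mod j P \<Longrightarrow> 0 < length cs \<Longrightarrow> length cs \<le> j \<Longrightarrow> P cs = 0"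
  by (simp add: unit_mod_def)

lemma unit_mod_Suc:
  assumes "unit_mod j P" "\<And>cs. length cs = Suc j \<Longrightarrow> P cs = 0"
  shows "unit_mod (Suc j) P"
  using assms by (auto simp: unit_mod_def le_Suc_eq)

lemma conv_split_ends:
  assumes "cs \<noteq> []" "P [] = 1" "Q [] = 1"
  shows "conv P Q cs = P cs + Q cs + (\<Sum>i\<in>{0<..<length cs}. P (take i cs) * Q (drop i cs))"
proof -
  have "{..length cs} = insert 0 (insert (length cs) {0<..<length cs})"
    using assms(1) by auto
  then show ?thesis using assms by (simp add: conv_def add.commute add.left_commute)
qed

text \<open>A nonzero mixed term takes degree at least i + 1 from \<open>P\<close> and j + 1 from
  \<open>Q\<close>, hence has total degree at least i + j + 2.\<close>

lemma conv_unit_mod_low: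
  assumes "unit_mod i P" "unit_mod j Q" "cs \<noteq> []" "length cs \<le> Suc (i + j)"
  shows "conv P Q cs = P cs + Q cs"
proof -
  have "P (take m cs) * Q (drop m cs) = 0" if "m \<in> {0<..<length cs}" for m
  proof (cases "m \<le> i")
    case True
    then have "P (take m cs) = 0" using that by (intro unit_mod_eq_0[OF assms(1)]) auto
    then show ?thesis by simp
  next
    case False
    then have "Q (drop m cs) = 0" using assms that by (intro unit_mod_eq_0[OF assms(2)]) auto
    then show ?thesis by simp
  qed
  then show ?thesis
    using assms conv_split_ends[of cs P Q] by (simp add: unit_mod_def)
qed

lemma conv_unit_mod_mixed:
  assumes "unit_mod i P" "unit_mod j Q" "length cs = Suc (Suc (i + j))"
  shows "conv P Q cs = P cs + Q cs + P (take (Suc i) cs) * Q (drop (Suc i) cs)"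
proof -
  have *: "P (take m cs) * Q (drop m cs) = 0" if "m \<in> {0<..<length cs}" "m \<noteq> Suc i" for m
  proof (cases "m \<le> i")
    case True
    then have "P (take m cs) = 0" using that by (intro unit_mod_eq_0[OF assms(1)]) auto
    then show ?thesis by simp
  next
    case False
    then have "Q (drop m cs) = 0" using assms that by (intro unit_mod_eq_0[OF assms(2)]) auto
    then show ?thesis by simp
  qed
  have "(\<Sum>m\<in>{0<..<length cs}. P (take m cs) * Q (drop m cs))
      = (\<Sum>m\<in>{Suc i}. P (take m cs) * Q (drop m cs))"
    using assms(3) * by (intro sum.mono_neutral_right) auto
  then show ?thesis
    using assms conv_split_ends[of cs P Q] by (cases cs) (auto simp: unit_mod_def)
qed

lemma unit_mod_conv:
  assumes "unit_mod j P" "unit_mod j Q"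
  shows "unit_mod j (conv P Q)"
  unfolding unit_mod_def
proof (intro conjI allI impI)
  show "conv P Q [] = 1" using assms by (simp add: unit_mod_def)
next
  fix cs :: "'a list" assume "0 < length cs \<and> length cs \<le> j"
  then show "conv P Q cs = 0"
    using assms conv_unit_mod_low[OF assms, of cs] by (auto simp: unit_mod_def)
qed

text \<open>Induction on the degree: once \<open>Q\<close> is known to be 1 through degree
  \<open>i\<close>, the product is additive in degree i + 1, so there the coefficients of
  \<open>P\<close> and \<open>Q\<close> cancel.\<close>

lemma unit_mod_inverse:
  assumes "unit_mod j P" "Q [] = 1" "\<And>cs. conv P Q cs = unit_series cs"
  shows "unit_mod j Q" "length cs = Suc j \<Longrightarrow> Q cs = - P cs"
proof -
  have Q: "unit_mod i Q" if "i \<le> j" for i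
    using that
  proof (induction i)
    case 0
    then show ?case using assms(2) by (simp add: unit_mod_def)
  next
    case (Suc i)
    show ?case
    proof (rule unit_mod_Suc)
      show "unit_mod i Q" using Suc by simp
      fix cs :: "'a list" assume cs: "length cs = Suc i"
      then have "conv P Q cs = P cs + Q cs"
        using Suc by (intro conv_unit_mod_low[OF assms(1), of i]) auto
      moreover have "P cs = 0" using cs Suc by (intro unit_mod_eq_0[OF assms(1)]) auto
      ultimately show "Q cs = 0" using cs assms(3)[of cs] by (cases cs) auto
    qed
  qed
  then show "unit_mod j Q" by simp
  assume cs: "length cs = Suc j"
  then have "conv P Q cs = P cs + Q cs"
    by (intro conv_unit_mod_low[OF assms(1) Q]) auto
  moreover have "conv P Q cs = 0" using cs assms(3)[of cs] by (cases cs) auto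
  ultimately show "Q cs = - P cs" by (simp add: add_eq_0_iff)
qed

text \<open>Both products are compared degree by degree. Through degree j + 1 they are additive,
  which forces \<open>C\<close> to be 1; in degree j + 2 each of \<open>P Q\<close> and
  \<open>Q P\<close> has a single mixed term, and their difference is the Lie bracket of the leading
  part of \<open>P\<close> with the linear part of \<open>Q\<close>.\<close>

lemma unit_mod_commutator:
  assumes P: "unit_mod j P" and Q: "unit_mod 0 Q" and C: "C [] = 1"
    and eq: "\<And>cs. conv C (conv Q P) cs = conv P Q cs"
  shows "unit_mod (Suc j) C"
    and "length cs = Suc (Suc j) \<Longrightarrow>
      C cs = P (take (Suc j) cs) * Q (drop (Suc j) cs) - Q (take 1 cs) * P (drop 1 cs)"
proof -
  have D: "unit_mod 0 (conv Q P)" using P Q by (simp add: unit_mod_def)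
  have U: "unit_mod i C" if "i \<le> Suc j" for i
    using that
  proof (induction i)
    case 0
    then show ?case using C by (simp add: unit_mod_def)
  next
    case (Suc i)
    show ?case
    proof (rule unit_mod_Suc)
      show "unit_mod i C" using Suc by simp
      fix cs :: "'a list" assume cs: "length cs = Suc i"
      then have ne: "cs \<noteq> []" by auto
      have "conv C (conv Q P) cs = C cs + conv Q P cs"
        using Suc cs ne by (intro conv_unit_mod_low[OF _ D, of i]) auto
      moreover have "conv Q P cs = Q cs + P cs"
        using Suc cs ne by (intro conv_unit_mod_low[OF Q P]) auto
      moreover have "conv P Q cs = P cs + Q cs"
        using Suc cs ne by (intro conv_unit_mod_low[OF P Q]) auto
      ultimately show "C cs = 0" using eq[of cs] by (simp add: add.commute)
    qed
  qed
  then show U1: "unit_mod (Suc j) C" by simp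
  assume cs: "length cs = Suc (Suc j)"
  then have ne: "cs \<noteq> []" by auto
  have "C cs + conv Q P cs = conv P Q cs"
    using cs ne conv_unit_mod_low[OF U1 D, of cs] eq[of cs] by auto
  moreover have "conv Q P cs = Q cs + P cs + Q (take 1 cs) * P (drop 1 cs)"
    using conv_unit_mod_mixed[OF Q P, of cs] cs by simp
  moreover have "conv P Q cs = P cs + Q cs + P (take (Suc j) cs) * Q (drop (Suc j) cs)"
    using conv_unit_mod_mixed[OF P Q, of cs] cs by simp
  ultimately show "C cs = P (take (Suc j) cs) * Q (drop (Suc j) cs) - Q (take 1 cs) * P (drop 1 cs)"
    by (simp add: algebra_simps)
qed

subsection \<open>Homomorphisms from a group to power series\<close>

text \<open>Abstract in \<open>N\<close> because two instances are used: the Magnus expansion, and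
  its composite with a retraction onto a factor. \<open>N_one\<close> is assumed because a
  homomorphism into a mere monoid need not preserve the unit.\<close>

locale series_hom = group G for G (structure) +
  fixes N :: "'a \<Rightarrow> ('c, 'r::comm_ring_1) series"
 
  assumes hom: "N \<in> hom G series_monoid" and N_one: "N \<one> = unit_series"
    and N_const: "\<And>x. x \<in> carrier G \<Longrightarrow> N x [] = 1"
begin

lemma N_mult: "x \<in> carrier G \<Longrightarrow> y \<in> carrier G \<Longrightarrow> N (x \<otimes> y) = conv (N x) (N y)"
  using hom_mult[OF hom] by simp

lemma N_inv: "x \<in> carrier G \<Longrightarrow> conv (N x) (N (inv x)) = unit_series"
  using N_mult[of x "inv x"] by (simp add: N_one)

lemma N_Nil [simp]: "x \<in> carrier G \<Longrightarrow> N x [] = 1"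
  by (simp add: N_const)

lemma unit_mod_0: "x \<in> carrier G \<Longrightarrow> unit_mod 0 (N x)"
  by (simp add: unit_mod_def)

lemma N_commutator:
  assumes "unit_mod j (N x)" "x \<in> carrier G" "g \<in> carrier G"
  shows "unit_mod (Suc j) (N (commutator G x g))"
    and "length cs = Suc (Suc j) \<Longrightarrow> N (commutator G x g) cs
      = N x (take (Suc j) cs) * N g (drop (Suc j) cs) - N g (take 1 cs) * N x (drop 1 cs)"
proof -
  have eq: "conv (N (commutator G x g)) (conv (N g) (N x)) cs = conv (N x) (N g) cs" for cs
    using assms(2,3) N_mult[of "commutator G x g" "g \<otimes> x"] N_mult[of g x] N_mult[of x g]
    by (simp add: commutator_mult)
  have C: "N (commutator G x g) [] = 1" using assms by simp
  note * = unit_mod_commutator[OF assms(1) unit_mod_0[OF assms(3)] C eq]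
  show "unit_mod (Suc j) (N (commutator G x g))" by (rule *(1))
  show "length cs = Suc (Suc j) \<Longrightarrow> N (commutator G x g) cs
      = N x (take (Suc j) cs) * N g (drop (Suc j) cs) - N g (take 1 cs) * N x (drop 1 cs)"
    by (rule *(2))
qed

lemma unit_mod_lcs: "w \<in> lcs G j \<Longrightarrow> unit_mod j (N w)"
proof (induction j arbitrary: w)
  case 0
  then show ?case by (simp add: unit_mod_0)
next
  case (Suc j)
  from Suc.prems show ?case
  proof (induction rule: lcs_Suc_induct)
    case one
    show ?case by (simp add: N_one unit_mod_def unit_series_def)
  next
    case (commutator x g)
    show ?case
      by (rule N_commutator(1)[OF Suc.IH[OF commutator(1)] lcs_closed[OF commutator(1)] commutator(2)])
  next
    case (inv_commutator x g)
    have c: "commutator G x g \<in> carrier G"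
      by (rule commutator_closed[OF lcs_closed[OF inv_commutator(1)] inv_commutator(2)])
    show ?case
      by (rule unit_mod_inverse(1)[OF inv_commutator(4)]) (simp_all only: N_inv c N_Nil inv_closed)
  next
    case (mult u v)
    then show ?case by (simp only: N_mult lcs_closed[of _ "Suc j"] unit_mod_conv)
  qed
qed

lemma N_commutator_lcs:
  assumes "x \<in> lcs G j" "g \<in> carrier G" "length cs = Suc (Suc j)"
  shows "N (commutator G x g) cs
      = N x (take (Suc j) cs) * N g (drop (Suc j) cs) - N g (take 1 cs) * N x (drop 1 cs)"
  by (rule N_commutator(2)[OF unit_mod_lcs[OF assms(1)] lcs_closed[OF assms(1)] assms(2,3)])

lemma N_mult_lcs:
  assumes "u \<in> lcs G j" "v \<in> lcs G j" "length cs = Suc j"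
  shows "N (u \<otimes> v) cs = N u cs + N v cs"
  using assms lcs_closed[OF assms(1)] lcs_closed[OF assms(2)] N_mult[of u v]
    conv_unit_mod_low[OF unit_mod_lcs[OF assms(1)] unit_mod_lcs[OF assms(2)], of cs]
  by (cases cs) auto

lemma N_inv_lcs:
  assumes "u \<in> lcs G j" "length cs = Suc j"
  shows "N (inv u) cs = - N u cs"
  using assms lcs_closed[OF assms(1)]
  by (intro unit_mod_inverse(2)[OF unit_mod_lcs[OF assms(1)]]) (simp_all add: N_inv)

text \<open>With v the conjugate of u, the relation v g = g u is additive in degree j + 1, and the
  contribution of g cancels.\<close>

lemma N_conj_lcs:
  assumes "u \<in> lcs G j" "g \<in> carrier G" "length cs = Suc j"
  shows "N (g \<otimes> u \<otimes> inv g) cs = N u cs"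
proof -
  let ?v = "g \<otimes> u \<otimes> inv g"
  interpret lcs: normal "lcs G j" G by (rule lcs_normal)
  have v: "?v \<in> lcs G j" and u: "u \<in> carrier G"
    using assms lcs.inv_op_closed2 lcs.mem_carrier by auto
  have "conv (N ?v) (N g) = conv (N g) (N u)"
    using u assms(2) N_mult[of ?v g] N_mult[of g u] by (simp add: m_assoc)
  then have "N ?v cs + N g cs = N g cs + N u cs"
    using conv_unit_mod_low[OF unit_mod_lcs[OF v] unit_mod_0[OF assms(2)], of cs]
      conv_unit_mod_low[OF unit_mod_0[OF assms(2)] unit_mod_lcs[OF assms(1)], of cs] assms(3)
    by (cases cs) auto
  then show ?thesis by simp
qed

text \<open>By the bracket formula the leading coefficients are assembled from degree-one
  coefficients, one for each variable of the word. A variable therefore matters only through the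
  function g \<mapsto> \<open>N g [c]\<close>.\<close>

lemma N_lcs_cong:
  assumes "w \<in> lcs G j" "length cs = Suc j"
    and "list_all2 (\<lambda>c d. \<forall>g\<in>carrier G. N g [c] = N g [d]) cs ds"
  shows "N w cs = N w ds"
  using assms
proof (induction j arbitrary: w cs ds)
  case 0
  then show ?case by (auto simp: length_Suc_conv list_all2_Cons1)
next
  case (Suc j)
  have len: "length cs = length ds" using Suc.prems(3) by (rule list_all2_lengthD)
  have single: "N g es = N g fs"
    if "g \<in> carrier G" "length es = 1" "list_all2 (\<lambda>c d. \<forall>g\<in>carrier G. N g [c] = N g [d]) es fs"
    for g es fs
    using that by (auto simp: length_Suc_conv list_all2_Cons1)
  from Suc.prems(1) show ?case
  proof (induction rule: lcs_Suc_induct)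
    case one
    then show ?case using Suc.prems(2) len by (auto simp: N_one unit_series_def)
  next
    case (commutator x g)
    have "N x (take (Suc j) cs) = N x (take (Suc j) ds)"
      using commutator Suc.prems by (intro Suc.IH list_all2_takeI) auto
    moreover have "N x (drop 1 cs) = N x (drop 1 ds)"
      using commutator Suc.prems by (intro Suc.IH list_all2_dropI) auto
    moreover have "N g (drop (Suc j) cs) = N g (drop (Suc j) ds)"
      using commutator Suc.prems by (intro single list_all2_dropI) auto
    moreover have "N g (take 1 cs) = N g (take 1 ds)"
      using commutator Suc.prems by (intro single list_all2_takeI) auto
    ultimately show ?case
      using Suc.prems(2) len by (simp add: N_commutator_lcs[OF commutator])
  next
    case (inv_commutator x g)
    then show ?case using Suc.prems(2) len by (simp add: N_inv_lcs)
  next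
    case (mult u v)
    then show ?case using Suc.prems(2) len by (simp add: N_mult_lcs)
  qed
qed

end

section \<open>Automorphisms acting trivially modulo a normal subgroup\<close>

text \<open>Triviality modulo \<open>K\<close> can thus be tested on generators: on A and B for a
  supported automorphism, on the basis for a transvection. With \<open>K\<close> trivial the
  subgroup is the set of fixed points.\<close>

lemma (in group) subgroup_trivial_mod_normal:
  assumes K: "K \<lhd> G" and \<phi>: "\<phi> \<in> hom G G"
  shows "subgroup {g \<in> carrier G. \<phi> g \<otimes> inv g \<in> K} G"
proof -
  interpret K: normal K G by (rule K)
  interpret \<phi>: group_hom G G \<phi> by (simp add: group_hom_def group_hom_axioms_def \<phi>)
  show ?thesis
  proof (rule subgroupI)
    show "{g \<in> carrier G. \<phi> g \<otimes> inv g \<in> K} \<noteq> {}"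
      by (rule ex_in_conv[THEN iffD1], rule exI[of _ \<one>]) simp
  next
    fix g assume "g \<in> {g \<in> carrier G. \<phi> g \<otimes> inv g \<in> K}"
    then have g: "g \<in> carrier G" "\<phi> g \<otimes> inv g \<in> K" by auto
    have "inv g \<otimes> inv (\<phi> g \<otimes> inv g) \<otimes> g \<in> K"
      using g K.inv_op_closed1[of g "inv (\<phi> g \<otimes> inv g)"] by simp
    also have "inv g \<otimes> inv (\<phi> g \<otimes> inv g) \<otimes> g = \<phi> (inv g) \<otimes> inv (inv g)"
      using g(1) by (simp add: inv_mult_group flip: m_assoc)
    finally show "inv g \<in> {g \<in> carrier G. \<phi> g \<otimes> inv g \<in> K}" using g by simp
  next
    fix g h
    assume "g \<in> {g \<in> carrier G. \<phi> g \<otimes> inv g \<in> K}" "h \<in> {g \<in> carrier G. \<phi> g \<otimes> inv g \<in> K}"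
    then have gh: "g \<in> carrier G" "\<phi> g \<otimes> inv g \<in> K" "h \<in> carrier G" "\<phi> h \<otimes> inv h \<in> K" by auto
    \<comment> \<open>The displacement is a cocycle: that of g h is the displacement of g times the
      g-conjugate of that of h, and normality absorbs the conjugation.\<close>
    have "(\<phi> g \<otimes> inv g) \<otimes> (g \<otimes> (\<phi> h \<otimes> inv h) \<otimes> inv g) \<in> K"
      using gh K.inv_op_closed2[of g "\<phi> h \<otimes> inv h"] by simp
    also have "(\<phi> g \<otimes> inv g) \<otimes> (g \<otimes> (\<phi> h \<otimes> inv h) \<otimes> inv g)
        = \<phi> (g \<otimes> h) \<otimes> inv (g \<otimes> h)"
    proof -
      have "inv g \<otimes> (g \<otimes> z) = z" if "z \<in> carrier G" for z
        using gh that by (simp flip: m_assoc)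
      then show ?thesis using gh(1,3) by (simp add: inv_mult_group m_assoc)
    qed
    finally show "g \<otimes> h \<in> {g \<in> carrier G. \<phi> g \<otimes> inv g \<in> K}" using gh by simp
  qed auto
qed

text \<open>\<open>K\<close> is not known to be invariant under automorphisms. What rescues
  composites and inverses is that the condition holds at every \<open>g\<close>, in particular at
  the image of \<open>x\<close> under the other map.\<close>

lemma (in group) generate_AutoGroup_trivial_mod_normal:
  assumes K: "K \<lhd> G"
    and Gens: "\<And>\<phi>. \<phi> \<in> Gens \<Longrightarrow> \<phi> \<in> auto G"
      "\<And>\<phi> g. \<phi> \<in> Gens \<Longrightarrow> g \<in> carrier G \<Longrightarrow> \<phi> g \<otimes> inv g \<in> K"
    and \<phi>: "\<phi> \<in> generate (AutoGroup G) Gens" and g: "g \<in> carrier G"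
  shows "\<phi> g \<otimes> inv g \<in> K"
proof -
  interpret K: normal K G by (rule K)
  interpret Aut: group "AutoGroup G" by (rule AutoGroup)
  have car: "carrier (AutoGroup G) = auto G" by (simp add: AutoGroup_def)
  have clo: "\<psi> x \<in> carrier G" if "\<psi> \<in> auto G" "x \<in> carrier G" for \<psi> x
    using that by (auto simp: auto_def hom_def)
  have comp: "(\<psi> \<otimes>\<^bsub>AutoGroup G\<^esub> \<psi>') x = \<psi> (\<psi>' x)"
    if "\<psi> \<in> auto G" "\<psi>' \<in> auto G" "x \<in> carrier G" for \<psi> \<psi>' x
    using that by (simp add: AutoGroup_def BijGroup_def auto_def compose_def)
  have one_apply: "\<one>\<^bsub>AutoGroup G\<^esub> x = x" if "x \<in> carrier G" for x
    using that by (simp add: AutoGroup_def BijGroup_def)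
  have "\<phi> \<in> auto G \<and> (\<forall>g\<in>carrier G. \<phi> g \<otimes> inv g \<in> K)"
    using \<phi>
  proof (induction rule: generate.induct)
    case one
    then show ?case using Aut.one_closed car by (simp add: one_apply)
  next
    case (incl \<phi>)
    then show ?case using Gens by auto
  next
    case (inv \<phi>)
    define \<psi> where "\<psi> = inv\<^bsub>AutoGroup G\<^esub> \<phi>"
    have \<phi>: "\<phi> \<in> auto G" using inv Gens by auto
    then have \<psi>: "\<psi> \<in> auto G" unfolding \<psi>_def using Aut.inv_closed car by simp
    have "\<psi> x \<otimes> inv x \<in> K" if x: "x \<in> carrier G" for x
    proof -
      have "\<phi> \<otimes>\<^bsub>AutoGroup G\<^esub> \<psi> = \<one>\<^bsub>AutoGroup G\<^esub>" unfolding \<psi>_def using \<phi> car by simp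
      then have "\<phi> (\<psi> x) = x" using comp[OF \<phi> \<psi> x] one_apply[OF x] by simp
      then have "x \<otimes> inv (\<psi> x) \<in> K" using Gens(2)[OF inv clo[OF \<psi> x]] by simp
      then have "inv (x \<otimes> inv (\<psi> x)) \<in> K" by simp
      then show ?thesis using x clo[OF \<psi> x] by (simp add: inv_mult_group)
    qed
    then show ?case using \<psi> unfolding \<psi>_def by simp
  next
    case (eng \<phi> \<psi>)
    have "\<phi> \<otimes>\<^bsub>AutoGroup G\<^esub> \<psi> \<in> auto G" using Aut.m_closed eng car by simp
    moreover have "(\<phi> \<otimes>\<^bsub>AutoGroup G\<^esub> \<psi>) x \<otimes> inv x \<in> K" if x: "x \<in> carrier G" for x
    proof -
      let ?y = "\<psi> x"
      have y: "?y \<in> carrier G" and z: "\<phi> ?y \<in> carrier G" using clo x eng by auto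
      have "(\<phi> ?y \<otimes> inv ?y) \<otimes> (?y \<otimes> inv x) \<in> K" using eng x y by simp
      also have "(\<phi> ?y \<otimes> inv ?y) \<otimes> (?y \<otimes> inv x) = \<phi> ?y \<otimes> inv x"
      proof -
        have "inv ?y \<otimes> (?y \<otimes> inv x) = inv x" using y x by (simp flip: m_assoc)
        then show ?thesis using x y z by (simp add: m_assoc)
      qed
      finally show ?thesis using eng x comp by simp
    qed
    ultimately show ?case by blast
  qed
  then show ?thesis using g by blast
qed

section \<open>The retraction onto a free factor\<close>

text \<open>Erasing the B-syllables respects all relations. A word with a trivial syllable, or with
  two neighbours from one factor, is shortened without changing either value; any other nonempty
  word contradicts freeness.\<close>

lemma (in group) free_splitting_trivial_word:
  assumes split: "free_splitting G A B"
    and "\<forall>(s, g)\<in>set ws. g \<in> (if s then A else B)" "listprod G (map snd ws) = \<one>"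
  shows "listprod G (map (\<lambda>(s, g). if s then g else \<one>) ws) = \<one>"
  using assms(2,3)
proof (induction "length ws" arbitrary: ws rule: less_induct)
  case less
  let ?f = "\<lambda>(s, g). if s then g else \<one>"
  interpret A: subgroup A G using split by (simp add: free_splitting_def)
  interpret B: subgroup B G using split by (simp add: free_splitting_def)
  have car: "snd p \<in> carrier G \<and> ?f p \<in> carrier G" if "p \<in> set ws" for p
    using that less.prems(1) by (cases p) (auto split: if_splits)
  consider "ws = []" | i where "i < length ws" "snd (ws ! i) = \<one>"
    | i where "Suc i < length ws" "fst (ws ! i) = fst (ws ! Suc i)"
  proof -
    assume empty: thesis if "ws = []"
    assume trivial: thesis if "i < length ws" "snd (ws ! i) = \<one>" for i
    assume repeat: thesis if "Suc i < length ws" "fst (ws ! i) = fst (ws ! Suc i)" for i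
    show thesis
    proof (rule ccontr)
      assume n: "\<not> thesis"
      have "ws \<noteq> []" using n empty by auto
      moreover have "\<forall>(s, g)\<in>set ws. g \<in> (if s then A else B) \<and> g \<noteq> \<one>"
        using n trivial less.prems(1) by (auto simp: in_set_conv_nth) (metis snd_conv)+
      moreover have "\<forall>i. Suc i < length ws \<longrightarrow> fst (ws ! i) \<noteq> fst (ws ! Suc i)"
        using n repeat by auto
      ultimately have "listprod G (map snd ws) \<noteq> \<one>" using split unfolding free_splitting_def by blast
      then show False using less.prems(2) by simp
    qed
  qed
  then show ?case
  proof cases
    case 1
    then show ?thesis by simp
  next
    case (2 i)
    define xs ys p where "xs = take i ws" and "ys = drop (Suc i) ws" and "p = ws ! i"
    have ws: "ws = xs @ p # ys" using 2 id_take_nth_drop[of i ws] by (simp add: xs_def ys_def p_def)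
    have p: "snd p = \<one>" "?f p = \<one>" using 2 by (cases p, simp add: p_def)+
    have c: "set (map snd xs) \<subseteq> carrier G" "set (map snd ys) \<subseteq> carrier G"
      "set (map ?f xs) \<subseteq> carrier G" "set (map ?f ys) \<subseteq> carrier G"
      using car ws by auto
    have "listprod G (map snd (xs @ ys)) = \<one>"
      using less.prems(2) c p unfolding ws by (simp add: listprod_append)
    then have "listprod G (map ?f (xs @ ys)) = \<one>"
      using less.prems(1) ws by (intro less.hyps) auto
    then show ?thesis using c p unfolding ws by (simp add: listprod_append)
  next
    case (3 i)
    define xs ys p q where "xs = take i ws" and "ys = drop (Suc (Suc i)) ws"
      and "p = ws ! i" and "q = ws ! Suc i"
    have ws: "ws = xs @ p # q # ys"
      using 3 id_take_nth_drop[of i ws] Cons_nth_drop_Suc[of "Suc i" ws]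
      by (simp add: xs_def ys_def p_def q_def)
    obtain s g h where pq: "p = (s, g)" "q = (s, h)" using 3 by (cases p; cases q) (auto simp: p_def q_def)
    have c: "set (map snd xs) \<subseteq> carrier G" "set (map snd ys) \<subseteq> carrier G"
      "set (map ?f xs) \<subseteq> carrier G" "set (map ?f ys) \<subseteq> carrier G"
      "g \<in> carrier G" "h \<in> carrier G"
      using car[of p] car[of q] car ws pq by auto
    let ?ws = "xs @ (s, g \<otimes> h) # ys"
    have "listprod G (map snd ?ws) = \<one>"
      using less.prems(2) c unfolding ws pq by (simp add: listprod_append m_assoc)
    then have "listprod G (map ?f ?ws) = \<one>"
      using less.prems(1) ws pq by (intro less.hyps) (auto split: if_splits)
    then show ?thesis using c unfolding ws pq by (cases s) (simp_all add: listprod_append m_assoc)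
  qed
qed

lemma (in group) free_splitting_retraction:
  assumes split: "free_splitting G A B"
  obtains \<rho> where "\<rho> \<in> hom G G" "\<And>a. a \<in> A \<Longrightarrow> \<rho> a = a" "\<rho> ` carrier G = A"
proof -
  interpret A: subgroup A G using split by (simp add: free_splitting_def)
  interpret B: subgroup B G using split by (simp add: free_splitting_def)
  let ?f = "\<lambda>(s, g). if s then g else \<one>"
  define valid where "valid ws \<longleftrightarrow> (\<forall>(s, g)\<in>set ws. g \<in> (if s then A else B))" for ws
  define val where "val ws = listprod G (map snd ws)" for ws :: "(bool \<times> 'a) list"
  define valA where "valA ws = listprod G (map ?f ws)" for ws
  have carA: "?f p \<in> A" "snd p \<in> carrier G" if "valid ws" "p \<in> set ws" for ws p
    using that unfolding valid_def by (cases p; auto split: if_splits)+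
  have val_closed: "val ws \<in> carrier G" if "valid ws" for ws
    unfolding val_def using carA[OF that] by (intro listprod_closed) auto
  have valA_closed: "valA ws \<in> A" if "valid ws" for ws
    using that
  proof (induction ws)
    case (Cons p ws)
    then have "valid ws" "?f p \<in> A" using carA[OF Cons.prems, of p] by (auto simp: valid_def)
    then show ?case using Cons.IH unfolding valA_def by simp
  qed (simp add: valA_def)
  have val_append: "val (us @ vs) = val us \<otimes> val vs" if "valid us" "valid vs" for us vs
    unfolding val_def map_append using carA(2)[OF that(1)] carA(2)[OF that(2)]
    by (intro listprod_append) auto
  have valA_append: "valA (us @ vs) = valA us \<otimes> valA vs" if "valid us" "valid vs" for us vs
    unfolding valA_def map_append using carA(1)[OF that(1)] carA(1)[OF that(2)] A.subset
    by (intro listprod_append) auto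
  have valid_append: "valid (us @ vs) \<longleftrightarrow> valid us \<and> valid vs" for us vs
    by (auto simp: valid_def)
  have ex: "\<exists>ws. valid ws \<and> val ws = g" if "g \<in> carrier G" for g
  proof -
    have single: "\<exists>ws. valid ws \<and> val ws = g" if "g \<in> A \<union> B" for g
      using that by (intro exI[of _ "[(g \<in> A, g)]"]) (auto simp: valid_def val_def)
    have "g \<in> generate G (A \<union> B)" using split that by (simp add: free_splitting_def)
    then show ?thesis
    proof (induction rule: generate.induct)
      case one
      show ?case by (rule exI[of _ "[]"]) (simp add: valid_def val_def)
    next
      case (incl h)
      then show ?case by (rule single)
    next
      case (inv h)
      then show ?case by (intro single) auto
    next
      case (eng g h)
      then show ?case by (metis valid_append val_append)
    qed
  qed
  have unique: "valA us = valA vs" if us: "valid us" and vs: "valid vs" and eq: "val us = val vs" for us vs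
  proof -
    \<comment> \<open>One word for the inverse completes both \<open>us\<close> and
      \<open>vs\<close> to words for the identity, so the same factor \<open>valA ws\<close> cancels
      both A-values.\<close>
    obtain ws where ws: "valid ws" "val ws = inv (val us)" using ex val_closed[OF us] by blast
    have "valA us \<otimes> valA ws = \<one>"
      using free_splitting_trivial_word[OF split, of "us @ ws"] us vs eq ws val_closed
        val_append valA_append valid_append[of us ws]
      by (simp add: valid_def val_def valA_def)
    moreover have "valA vs \<otimes> valA ws = \<one>"
      using free_splitting_trivial_word[OF split, of "vs @ ws"] us vs eq ws val_closed
        val_append valA_append valid_append[of vs ws]
      by (simp add: valid_def val_def valA_def)
    ultimately show ?thesis using valA_closed us vs ws(1) by (metis A.mem_carrier r_cancel)
  qed
  define \<rho> where "\<rho> g = valA (SOME ws. valid ws \<and> val ws = g)" for g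
  have \<rho>: "\<rho> (val ws) = valA ws" if "valid ws" for ws
  proof -
    have "valid (SOME us. valid us \<and> val us = val ws)
        \<and> val (SOME us. valid us \<and> val us = val ws) = val ws"
      by (rule someI[of _ ws]) (simp add: that)
    then show ?thesis unfolding \<rho>_def using that by (intro unique) simp_all
  qed
  show ?thesis
  proof
    have "\<rho> (g \<otimes> h) = \<rho> g \<otimes> \<rho> h" if "g \<in> carrier G" "h \<in> carrier G" for g h
      using ex[OF that(1)] ex[OF that(2)] by (metis \<rho> valA_append val_append valid_append)
    moreover have "\<rho> g \<in> A" if "g \<in> carrier G" for g
      using ex[OF that] \<rho> valA_closed by metis
    moreover show *: "\<rho> a = a" if "a \<in> A" for a
      using \<rho>[of "[(True, a)]"] that by (simp add: valid_def val_def valA_def)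
    ultimately show "\<rho> \<in> hom G G" "\<rho> ` carrier G = A"
      by (auto simp: hom_def) (metis A.mem_carrier image_eqI)
  qed
qed

text \<open>The \<open>LEAST\<close> in the rank is meaningful only once some finite generating set
  is exhibited.\<close>

lemma subgroup_rank_attained:
  assumes "finite S" "S \<subseteq> A" "generate G S = A"
  obtains T where "finite T" "card T = subgroup_rank G A" "T \<subseteq> A" "generate G T = A"
proof -
  have "\<exists>T. finite T \<and> card T = subgroup_rank G A \<and> T \<subseteq> A \<and> generate G T = A"
    unfolding subgroup_rank_def by (rule LeastI_ex) (use assms in auto)
  then show ?thesis using that by auto
qed

section \<open>The Magnus expansion modulo 2\<close>

text \<open>The variables are sets of indices. A variable \<open>c\<close> stands for the linear form
  \<open>x\<^sub>i \<mapsto> [i \<in> c]\<close> on the abelianisation modulo 2, and the coefficient at a word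
  \<open>c\<^sub>1 \<dots> c\<^sub>m\<close> is the value of \<open>c\<^sub>1 \<otimes> \<dots> \<otimes> c\<^sub>m\<close> on the degree-\<open>m\<close> part of the usual
  Magnus expansion.\<close>

fun magnus_letter :: "letter \<Rightarrow> (nat set, bit) series" where
  "magnus_letter (i, True) cs =
     (case cs of [] \<Rightarrow> 1 | [c] \<Rightarrow> of_bool (i \<in> c) | _ \<Rightarrow> 0)"
| "magnus_letter (i, False) cs = of_bool (\<forall>c\<in>set cs. i \<in> c)"

definition magnus :: "letter list \<Rightarrow> (nat set, bit) series" where
  "magnus w = listprod series_monoid (map magnus_letter w)"

lemma bit_add_self [simp]: "(x :: bit) + x = 0"
  by (cases x) simp_all

lemma magnus_letter_Nil [simp]: "magnus_letter l [] = 1"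
  by (cases "(l, [] :: nat set list)" rule: magnus_letter.cases) simp_all

lemma magnus_letter_single [simp]: "magnus_letter l [c] = of_bool (fst l \<in> c)"
  by (cases "(l, [c])" rule: magnus_letter.cases) simp_all

text \<open>The series of an inverse letter is the geometric series 1 + x + x^2 + ..., whose signs
  disappear modulo 2.\<close>

lemma magnus_letter_inverse:
  "conv (magnus_letter l) (magnus_letter (inv_letter l)) = unit_series"
proof
  fix cs
  obtain i b where l: "l = (i, b)" by (cases l)
  have pos: "(\<lambda>ds. magnus_letter (i, True) (c # ds)) = (\<lambda>ds. of_bool (i \<in> c) * unit_series ds)" for c
    by (auto simp: fun_eq_iff unit_series_def split: list.splits)
  have neg: "(\<lambda>ds. magnus_letter (i, False) (c # ds))
      = (\<lambda>ds. of_bool (i \<in> c) * magnus_letter (i, False) ds)" for c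
    by (auto simp: fun_eq_iff)
  have "conv (magnus_letter (i, True)) (magnus_letter (i, False)) cs = unit_series cs"
  proof (cases cs)
    case (Cons c ds)
    have "conv (magnus_letter (i, True)) (magnus_letter (i, False)) (c # ds)
        = magnus_letter (i, False) (c # ds) + of_bool (i \<in> c) * magnus_letter (i, False) ds"
      unfolding conv_Cons pos conv_scale_left conv_unit_left by simp
    also have "\<dots> = 0" by auto
    finally show ?thesis by (simp add: Cons)
  qed simp
  moreover have "conv (magnus_letter (i, False)) (magnus_letter (i, True)) cs = unit_series cs"
  proof (induction cs)
    case (Cons c ds)
    have "conv (magnus_letter (i, False)) (magnus_letter (i, True)) (c # ds)
        = magnus_letter (i, True) (c # ds) + of_bool (i \<in> c) * unit_series ds"
      unfolding conv_Cons neg conv_scale_left Cons by simp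
    also have "\<dots> = 0" by (cases ds) auto
    finally show ?case by (simp del: magnus_letter.simps)
  qed simp
  ultimately show "conv (magnus_letter l) (magnus_letter (inv_letter l)) cs = unit_series cs"
    by (cases b) (simp_all add: l inv_letter_def)
qed

lemma magnus_Nil_word [simp]: "magnus [] = unit_series"
  and magnus_Cons: "magnus (l # w) = conv (magnus_letter l) (magnus w)"
  by (simp_all add: magnus_def)

lemma magnus_Nil [simp]: "magnus w [] = 1"
  by (induction w) (simp_all add: magnus_Cons)

lemma magnus_Cons_single: "magnus (l # w) [c] = of_bool (fst l \<in> c) + magnus w [c]"
  unfolding magnus_Cons conv_Cons by (simp add: add.commute)

lemma magnus_gen_single [simp]: "magnus (gen i) [c] = of_bool (i \<in> c)"
  by (simp add: magnus_Cons_single)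

text \<open>The reason for taking sets as variables: symmetric difference is the addition of linear
  forms modulo 2.\<close>

lemma magnus_sym_diff: "magnus w [sym_diff c d] = magnus w [c] + magnus w [d]"
proof (induction w)
  case (Cons l w)
  have "(of_bool (fst l \<in> sym_diff c d) :: bit) = of_bool (fst l \<in> c) + of_bool (fst l \<in> d)"
    by (cases "fst l \<in> c"; cases "fst l \<in> d") simp_all
  then show ?case
    unfolding magnus_Cons_single Cons by (simp only: add.assoc add.left_commute)
qed simp

lemma magnus_hom: "magnus \<in> hom (free_group n) series_monoid"
proof -
  have "(\<lambda>w. listprod series_monoid (map magnus_letter w)) \<in> hom (free_group n) series_monoid"
    by (rule listprod_map_hom) (simp_all add: monoid_series magnus_letter_inverse)
  then show ?thesis unfolding magnus_def .
qed

lemma series_hom_magnus: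
  assumes "\<rho> \<in> hom (free_group n) (free_group n)"
  shows "series_hom (free_group n) (\<lambda>w. magnus (\<rho> w))"
proof -
  interpret F: group "free_group n" by (rule group_free_group)
  have "(\<lambda>w. magnus (\<rho> w)) \<in> hom (free_group n) series_monoid"
    using hom_compose[OF assms magnus_hom] by (simp add: comp_def)
  moreover have "\<rho> [] = []"
    using hom_one[OF assms F.is_group F.is_group] by simp
  ultimately show ?thesis
    by (intro series_hom.intro series_hom_axioms.intro F.is_group) simp_all
qed

lemma series_hom_magnus_id: "series_hom (free_group n) magnus"
  using series_hom_magnus[of "\<lambda>w. w" n] by (simp add: hom_def)

section \<open>The alternating trace\<close>

text \<open>The functional \<open>{a} \<otimes> det({0}, \<dots>, {k - 1})\<close> on the degree-\<open>(k + 1)\<close> part: modulo 2 the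
  determinant is the permanent, which by inclusion-exclusion is the sum of the pure powers
  \<open>S \<otimes> \<dots> \<otimes> S\<close> over all \<open>S \<subseteq> {..<k}\<close>.\<close>

definition alt_trace :: "nat \<Rightarrow> nat \<Rightarrow> letter list \<Rightarrow> bit" where
  "alt_trace a k w = (\<Sum>S\<in>Pow {..<k}. magnus w ({a} # replicate k S))"

text \<open>Inside gamma_(k+1) the trace reads off the leading term, so it is additive and invariant
  under conjugation; this makes the set a normal subgroup.\<close>

definition trace_kernel :: "nat \<Rightarrow> nat \<Rightarrow> nat \<Rightarrow> letter list set" where
  "trace_kernel n a k = {w \<in> lcs (free_group n) k. alt_trace a k w = 0}"

lemma trace_kernel_normal: "trace_kernel n a k \<lhd> free_group n"
proof -
  interpret series_hom "free_group n" magnus by (rule series_hom_magnus_id)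
  interpret L: normal "lcs (free_group n) k" "free_group n" by (rule lcs_normal)
  have mult: "alt_trace a k (u \<otimes>\<^bsub>free_group n\<^esub> v) = alt_trace a k u + alt_trace a k v"
    if "u \<in> lcs (free_group n) k" "v \<in> lcs (free_group n) k" for u v
    unfolding alt_trace_def sum.distrib[symmetric]
    by (intro sum.cong refl N_mult_lcs[OF that]) simp
  have inv: "alt_trace a k (inv\<^bsub>free_group n\<^esub> u) = - alt_trace a k u"
    if "u \<in> lcs (free_group n) k" for u
    unfolding alt_trace_def sum_negf[symmetric]
    by (intro sum.cong refl N_inv_lcs[OF that]) simp
  have conj: "alt_trace a k (g \<otimes>\<^bsub>free_group n\<^esub> u \<otimes>\<^bsub>free_group n\<^esub> inv\<^bsub>free_group n\<^esub> g) = alt_trace a k u"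
    if "u \<in> lcs (free_group n) k" "g \<in> carrier (free_group n)" for u g
    unfolding alt_trace_def
    by (intro sum.cong refl N_conj_lcs[OF that]) simp
  have one: "alt_trace a k \<one>\<^bsub>free_group n\<^esub> = 0"
    using mult[OF L.one_closed L.one_closed] by simp
  have sub: "subgroup (trace_kernel n a k) (free_group n)"
  proof (rule subgroupI)
    show "trace_kernel n a k \<subseteq> carrier (free_group n)"
      using lcs_subset[of k] by (auto simp: trace_kernel_def)
    show "trace_kernel n a k \<noteq> {}"
      using one L.one_closed by (auto simp: trace_kernel_def)
  next
    fix u assume "u \<in> trace_kernel n a k"
    then show "inv\<^bsub>free_group n\<^esub> u \<in> trace_kernel n a k"
      using L.m_inv_closed[of u] inv[of u] by (simp add: trace_kernel_def)
  next
    fix u v assume "u \<in> trace_kernel n a k" "v \<in> trace_kernel n a k"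
    then show "u \<otimes>\<^bsub>free_group n\<^esub> v \<in> trace_kernel n a k"
      unfolding trace_kernel_def using L.m_closed[of u v] mult[of u v] by (simp del: mult_free_group)
  qed
  show ?thesis
  proof (rule normal_invI[OF sub])
    fix x h assume "x \<in> carrier (free_group n)" "h \<in> trace_kernel n a k"
    then show "x \<otimes>\<^bsub>free_group n\<^esub> h \<otimes>\<^bsub>free_group n\<^esub> inv\<^bsub>free_group n\<^esub> x \<in> trace_kernel n a k"
      unfolding trace_kernel_def using L.inv_op_closed2[of x h] conj[of h x] by (simp del: mult_free_group)
  qed
qed

section \<open>Vanishing of the trace for factors of small rank\<close>

text \<open>Adding \<open>T\<close> toggles the membership of any fixed m in \<open>T\<close>, so it
  matches the subsets containing m with those avoiding m; the two halves are equal and cancel modulo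
  2.\<close>

lemma sum_Pow_sym_diff_invariant:
  fixes f :: "'a set \<Rightarrow> bit"
  assumes "finite U" "T \<subseteq> U" "T \<noteq> {}"
    and inv: "\<And>S. S \<subseteq> U \<Longrightarrow> f (sym_diff S T) = f S"
  shows "sum f (Pow U) = 0"
proof -
  obtain m where m: "m \<in> T" using assms(3) by auto
  have "sum f (Pow U) = sum f {S \<in> Pow U. m \<in> S} + sum f {S \<in> Pow U. m \<notin> S}"
    using assms(1) by (subst sum.union_disjoint[symmetric]) (auto intro: sum.cong)
  also have "sum f {S \<in> Pow U. m \<in> S} = sum f {S \<in> Pow U. m \<notin> S}"
    by (rule sum.reindex_bij_witness[of _ "\<lambda>S. sym_diff S T" "\<lambda>S. sym_diff S T"])
      (use m assms(2) inv in auto)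
  finally show ?thesis by (simp only: bit_add_self)
qed

text \<open>Linear algebra over the field with two elements by counting: there are more forms than
  patterns of values on \<open>E\<close>, so two distinct forms agree on \<open>E\<close> and their
  sum vanishes there.\<close>

lemma pigeonhole_sets:
  assumes "finite E" "card E < k"
  obtains T where "T \<subseteq> {..<k}" "T \<noteq> {}" "\<forall>x\<in>E. magnus x [T] = 0"
proof -
  define h where "h S = {x \<in> E. magnus x [S] = 1}" for S
  have "card (Pow E) < card (Pow {..<k})" using assms by (simp add: card_Pow)
  moreover have "h ` Pow {..<k} \<subseteq> Pow E" by (auto simp: h_def)
  ultimately have "\<not> inj_on h (Pow {..<k})"
    using assms(1) by (meson card_inj_on_le finite_Pow_iff not_less)
  then obtain S S' where S: "S \<subseteq> {..<k}" "S' \<subseteq> {..<k}" "h S = h S'" "S \<noteq> S'"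
    by (auto simp: inj_on_def)
  show ?thesis
  proof
    show "sym_diff S S' \<subseteq> {..<k}" "sym_diff S S' \<noteq> {}" using S by auto
    show "\<forall>x\<in>E. magnus x [sym_diff S S'] = 0"
    proof
      fix x assume "x \<in> E"
      then have "magnus x [S] = 1 \<longleftrightarrow> magnus x [S'] = 1" using S(3) by (auto simp: h_def)
      then have "magnus x [S] = magnus x [S']" by (cases "magnus x [S]"; cases "magnus x [S']") simp_all
      then show "magnus x [sym_diff S S'] = 0" unfolding magnus_sym_diff by (simp only: bit_add_self)
    qed
  qed
qed

lemma magnus_generate_zero:
  assumes "E \<subseteq> carrier (free_group n)" "\<And>x. x \<in> E \<Longrightarrow> magnus x [T] = 0"
    and "g \<in> generate (free_group n) E"
  shows "magnus g [T] = 0"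
proof -
  interpret series_hom "free_group n" magnus by (rule series_hom_magnus_id)
  from assms(3) show ?thesis
  proof (induction rule: generate.induct)
    case (inv h)
    then show ?case using assms(1,2) N_inv_lcs[of h 0 "[T]"] by auto
  next
    case (eng g h)
    then show ?case using generate_in_carrier[OF assms(1)] N_mult_lcs[of g 0 h "[T]"] by simp
  qed (use assms in simp_all)
qed

text \<open>An element of the factor \<open>A\<close> is fixed by the retraction onto \<open>A\<close>, so its coefficients depend
  only on the restrictions of the linear forms to \<open>A\<close>. As \<open>A\<close> has fewer than \<open>k\<close> generators, some
  nonempty \<open>T\<close> vanishes on \<open>A\<close>, and \<open>S \<mapsto> S + T\<close> cancels the terms of the trace in pairs.\<close>

lemma factor_lcs_subset_trace_kernel:
  assumes split: "free_splitting (free_group n) A B"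
    and rank: "subgroup_rank (free_group n) A < k"
    and w: "w \<in> A" "w \<in> lcs (free_group n) k"
  shows "w \<in> trace_kernel n a k"
proof -
  interpret F: group "free_group n" by (rule group_free_group)
  interpret A: subgroup A "free_group n" using split by (simp add: free_splitting_def)
  obtain \<rho> where \<rho>: "\<rho> \<in> hom (free_group n) (free_group n)"
    "\<And>a. a \<in> A \<Longrightarrow> \<rho> a = a" "\<rho> ` carrier (free_group n) = A"
    using F.free_splitting_retraction[OF split] by blast
  interpret \<rho>: group_hom "free_group n" "free_group n" \<rho>
    by (simp add: group_hom_def group_hom_axioms_def \<rho>(1) F.is_group)
  have gens: "gen ` {..<n} \<subseteq> carrier (free_group n)" by (auto simp: gen_in_carrier)
  \<comment> \<open>As the image of the retraction, \<open>A\<close> is finitely generated, so its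
    rank is attained.\<close>
  have img: "generate (free_group n) (\<rho> ` gen ` {..<n}) = A"
    using \<rho>.generate_img[OF gens] by (simp only: generate_gens \<rho>(3))
  have img_sub: "\<rho> ` gen ` {..<n} \<subseteq> A"
    unfolding \<rho>(3)[symmetric] using gens by (rule image_mono)
  have fin: "finite (\<rho> ` gen ` {..<n})" by (intro finite_imageI finite_lessThan)
  obtain E where E: "finite E" "card E = subgroup_rank (free_group n) A"
    "E \<subseteq> A" "generate (free_group n) E = A"
    by (rule subgroup_rank_attained[OF fin img_sub img])
  have "card E < k" using E(2) rank by simp
  with E(1) obtain T where T: "T \<subseteq> {..<k}" "T \<noteq> {}" "\<forall>x\<in>E. magnus x [T] = 0"
    by (rule pigeonhole_sets)
  have "E \<subseteq> carrier (free_group n)" using E(3) A.subset by (rule subset_trans)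
  then have vanish: "magnus g [T] = 0" if "g \<in> A" for g
    using magnus_generate_zero[of E n T g] T(3) that E(4) by blast
  \<comment> \<open>For this instance the degree-one function of a form depends only on its values
    on \<open>A\<close>, where \<open>T\<close> vanishes; hence \<open>sym_diff S T\<close> and
    \<open>S\<close> become interchangeable.\<close>
  interpret series_hom "free_group n" "\<lambda>w. magnus (\<rho> w)" by (rule series_hom_magnus[OF \<rho>(1)])
  have rep: "list_all2 P (replicate k c) (replicate k d)" if "P c d"
    for P :: "nat set \<Rightarrow> nat set \<Rightarrow> bool" and c d
    using that by (simp add: list_all2_conv_all_nth)
  have inv: "magnus w ({a} # replicate k (sym_diff S T)) = magnus w ({a} # replicate k S)" for S
  proof -
    have "\<forall>g\<in>carrier (free_group n). magnus (\<rho> g) [sym_diff S T] = magnus (\<rho> g) [S]"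
    proof
      fix g assume "g \<in> carrier (free_group n)"
      then have "\<rho> g \<in> A" unfolding \<rho>(3)[symmetric] by (rule imageI)
      then show "magnus (\<rho> g) [sym_diff S T] = magnus (\<rho> g) [S]"
        unfolding magnus_sym_diff by (simp only: vanish add_0_right)
    qed
    then have "list_all2 (\<lambda>c d. \<forall>g\<in>carrier (free_group n). magnus (\<rho> g) [c] = magnus (\<rho> g) [d])
        (replicate k (sym_diff S T)) (replicate k S)"
      by (rule rep)
    then have "magnus (\<rho> w) ({a} # replicate k (sym_diff S T)) = magnus (\<rho> w) ({a} # replicate k S)"
      by (intro N_lcs_cong[OF w(2)] list_all2_Cons[THEN iffD2] conjI)
        (simp_all only: length_Cons length_replicate ball_triv simp_thms)
    then show ?thesis unfolding \<rho>(2)[OF w(1)] .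
  qed
  have "alt_trace a k w = 0"
    unfolding alt_trace_def by (rule sum_Pow_sym_diff_invariant[OF finite_lessThan T(1,2)]) (rule inv)
  then show ?thesis using w(2) by (simp add: trace_kernel_def)
qed

lemma supported_trivial_mod_trace_kernel:
  assumes split: "free_splitting (free_group n) A B"
    and rank: "subgroup_rank (free_group n) A < k"
    and supp: "supported_on \<phi> A B" and \<phi>: "\<phi> \<in> IA n k"
    and g: "g \<in> carrier (free_group n)"
  shows "\<phi> g \<otimes>\<^bsub>free_group n\<^esub> inv\<^bsub>free_group n\<^esub> g \<in> trace_kernel n a k"
proof -
  interpret F: group "free_group n" by (rule group_free_group)
  interpret K: normal "trace_kernel n a k" "free_group n" by (rule trace_kernel_normal)
  interpret A: subgroup A "free_group n" using split by (simp add: free_splitting_def)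
  interpret B: subgroup B "free_group n" using split by (simp add: free_splitting_def)
  let ?H = "{g \<in> carrier (free_group n).
    \<phi> g \<otimes>\<^bsub>free_group n\<^esub> inv\<^bsub>free_group n\<^esub> g \<in> trace_kernel n a k}"
  have "\<phi> \<in> hom (free_group n) (free_group n)" using \<phi> by (simp add: IA_def auto_def)
  then have "subgroup ?H (free_group n)"
    by (rule F.subgroup_trivial_mod_normal[OF K.normal_axioms])
  moreover have "A \<subseteq> ?H"
  proof
    fix x assume x: "x \<in> A"
    then have "\<phi> x \<in> A" using supp by (auto simp: supported_on_def)
    then have "\<phi> x \<otimes>\<^bsub>free_group n\<^esub> inv\<^bsub>free_group n\<^esub> x \<in> A" using x by (intro A.m_closed) auto
    moreover have "\<phi> x \<otimes>\<^bsub>free_group n\<^esub> inv\<^bsub>free_group n\<^esub> x \<in> lcs (free_group n) k"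
      using \<phi> x by (simp add: IA_def gamma_def del: mult_free_group)
    ultimately show "x \<in> ?H"
      using factor_lcs_subset_trace_kernel[OF split rank] x by simp
  qed
  moreover have "B \<subseteq> ?H"
  proof
    fix x assume x: "x \<in> B"
    then have "\<phi> x = x" using supp by (simp add: supported_on_def)
    then show "x \<in> ?H" using x K.one_closed by (simp del: mult_free_group)
  qed
  ultimately have "generate (free_group n) (A \<union> B) \<subseteq> ?H"
    by (intro F.generate_subgroup_incl) auto
  then show ?thesis using split g by (auto simp: free_splitting_def)
qed

section \<open>Transvections\<close>

declare mult_free_group [simp del] one_free_group [simp del]

text \<open>The substitution x_k \<mapsto> u x_k v. The nested \<open>red\<close> is literally the
  product of u with (x_k v) in the free group.\<close>

definition transvection_letter :: "nat \<Rightarrow> letter list \<Rightarrow> letter list \<Rightarrow> letter \<Rightarrow> letter list" where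
  "transvection_letter k u v l =
     (if fst l \<noteq> k then [l]
      else if snd l then red (u @ red (gen k @ v))
      else inv_word (red (u @ red (gen k @ v))))"

definition transvection ::
    "nat \<Rightarrow> nat \<Rightarrow> letter list \<Rightarrow> letter list \<Rightarrow> letter list \<Rightarrow> letter list" where
  "transvection n k u v w = listprod (free_group n) (map (transvection_letter k u v) w)"

context
  fixes n k :: nat
  assumes k: "k < n"
begin

interpretation F: group "free_group n" by (rule group_free_group)

interpretation Fk: subgroup "carrier (free_group k)" "free_group n"
  using k by (intro subgroup_free_group) simp

lemma transvection_hom:
  assumes "u \<in> carrier (free_group k)" "v \<in> carrier (free_group k)"
  shows "transvection n k u v \<in> hom (free_group n) (free_group n)"
proof -
  have "u \<otimes>\<^bsub>free_group n\<^esub> (gen k \<otimes>\<^bsub>free_group n\<^esub> v) \<in> carrier (free_group n)"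
    using assms k Fk.mem_carrier by (simp add: gen_in_carrier)
  then have c: "red (u @ red (gen k @ v)) \<in> carrier (free_group n)" by (simp only: mult_free_group)
  have "(\<lambda>w. listprod (free_group n) (map (transvection_letter k u v) w))
      \<in> hom (free_group n) (free_group n)"
  proof (rule listprod_map_hom)
    fix l :: letter assume "fst l < n"
    then show "transvection_letter k u v l \<in> carrier (free_group n)"
      using c inv_word_closed[OF c]
      by (simp add: transvection_letter_def carrier_free_group[of "[l]"] reduced_Cons)
    show "transvection_letter k u v l \<otimes>\<^bsub>free_group n\<^esub> transvection_letter k u v (inv_letter l)
        = \<one>\<^bsub>free_group n\<^esub>"
      using red_inv_word_right[of "red (u @ red (gen k @ v))"]
        red_inv_word_right[of "inv_word (red (u @ red (gen k @ v)))"]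
      by (auto simp: transvection_letter_def mult_free_group one_free_group inv_letter_def)
  qed (rule F.is_monoid)
  then show ?thesis unfolding transvection_def .
qed

lemma transvection_fixes:
  assumes "w \<in> carrier (free_group n)" "k \<notin> fst ` set w"
  shows "transvection n k u v w = w"
proof -
  have "map (transvection_letter k u v) w = map (\<lambda>l. [l]) w"
    using assms(2) by (force simp: transvection_letter_def)
  then show ?thesis using assms(1)
    by (simp only: transvection_def listprod_singletons carrier_free_group red_reduced)
qed

lemma transvection_gen:
  "transvection n k u v (gen k) = u \<otimes>\<^bsub>free_group n\<^esub> (gen k \<otimes>\<^bsub>free_group n\<^esub> v)"
  by (simp add: transvection_def transvection_letter_def mult_free_group one_free_group)

text \<open>Neither \<open>u\<close> nor \<open>v\<close> contains the letter x_k, so the outer map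
  fixes their inverses and sends u^-1 x_k v^-1 to u^-1 (u x_k v) v^-1 = x_k.\<close>

lemma transvection_inverse:
  assumes u: "u \<in> carrier (free_group k)" and v: "v \<in> carrier (free_group k)"
    and w: "w \<in> carrier (free_group n)"
  shows "transvection n k u v (transvection n k (inv_word u) (inv_word v) w) = w"
proof -
  let ?\<phi> = "transvection n k u v" and ?\<psi> = "transvection n k (inv_word u) (inv_word v)"
  let ?H = "{g \<in> carrier (free_group n).
    (?\<phi> \<circ> ?\<psi>) g \<otimes>\<^bsub>free_group n\<^esub> inv\<^bsub>free_group n\<^esub> g \<in> {\<one>\<^bsub>free_group n\<^esub>}}"
  have u': "inv_word u \<in> carrier (free_group k)" and v': "inv_word v \<in> carrier (free_group k)"
    using u v by (auto intro: inv_word_closed)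
  have uF: "u \<in> carrier (free_group n)" and vF: "v \<in> carrier (free_group n)"
    using u v by auto
  have uinv: "inv_word u = inv\<^bsub>free_group n\<^esub> u" and vinv: "inv_word v = inv\<^bsub>free_group n\<^esub> v"
    using uF vF by (simp_all add: inv_free_group)
  interpret \<phi>: group_hom "free_group n" "free_group n" ?\<phi>
    by (simp add: group_hom_def group_hom_axioms_def transvection_hom u v F.is_group)
  have "?\<phi> \<circ> ?\<psi> \<in> hom (free_group n) (free_group n)"
    by (rule hom_compose[OF transvection_hom[OF u' v'] transvection_hom[OF u v]])
  then have sub: "subgroup ?H (free_group n)"
    by (rule F.subgroup_trivial_mod_normal[OF F.one_is_normal])
  have "?H = carrier (free_group n)"
  proof (rule free_group_subgroup_eq[OF sub])
    fix i assume i: "i < n"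
    have "?\<phi> (?\<psi> (gen i)) = gen i"
    proof (cases "i = k")
      case False
      then show ?thesis using i by (simp add: transvection_fixes gen_in_carrier)
    next
      case True
      have g: "gen k \<in> carrier (free_group n)" using k by (simp add: gen_in_carrier)
      have fix_u: "?\<phi> (inv_word u) = inv_word u" "?\<phi> (inv_word v) = inv_word v"
        using u' v' Fk.mem_carrier by (auto intro!: transvection_fixes simp: carrier_free_group)
      have "?\<phi> (?\<psi> (gen k)) = inv\<^bsub>free_group n\<^esub> u \<otimes>\<^bsub>free_group n\<^esub>
        ((u \<otimes>\<^bsub>free_group n\<^esub> (gen k \<otimes>\<^bsub>free_group n\<^esub> v)) \<otimes>\<^bsub>free_group n\<^esub> inv\<^bsub>free_group n\<^esub> v)"
        using fix_u g uF vF u v u' v' by (simp add: transvection_gen uinv vinv)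
      also have "\<dots> = gen k"
        using g uF vF by (simp add: F.m_assoc) (simp flip: F.m_assoc)
      finally show ?thesis using True by simp
    qed
    then show "gen i \<in> ?H" using i by (simp add: gen_in_carrier)
  qed
  then have "(?\<phi> \<circ> ?\<psi>) w \<otimes>\<^bsub>free_group n\<^esub> inv\<^bsub>free_group n\<^esub> w = \<one>\<^bsub>free_group n\<^esub>"
    using w by blast
  moreover have "(?\<phi> \<circ> ?\<psi>) w \<in> carrier (free_group n)"
    using w transvection_hom[OF u' v'] by (auto simp: hom_def Pi_iff)
  ultimately show ?thesis using w by (simp add: F.inv_solve_right')
qed

text \<open>Among the generators only x_k moves, so its displacement decides. The restriction is
  there because \<open>auto\<close> consists of extensional functions.\<close>

lemma transvection_in_IA:
  assumes u: "u \<in> carrier (free_group k)" and v: "v \<in> carrier (free_group k)"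
    and c: "u \<otimes>\<^bsub>free_group n\<^esub> (gen k \<otimes>\<^bsub>free_group n\<^esub> v) \<otimes>\<^bsub>free_group n\<^esub> inv\<^bsub>free_group n\<^esub> gen k
      \<in> lcs (free_group n) d"
  shows "restrict (transvection n k u v) (carrier (free_group n)) \<in> IA n d"
proof -
  let ?\<phi> = "transvection n k u v"
  interpret L: normal "lcs (free_group n) d" "free_group n" by (rule F.lcs_normal)
  have u': "inv_word u \<in> carrier (free_group k)" and v': "inv_word v \<in> carrier (free_group k)"
    using u v by (auto intro: inv_word_closed)
  have hom: "?\<phi> \<in> hom (free_group n) (free_group n)" by (rule transvection_hom[OF u v])
  have clo: "?\<phi> x \<in> carrier (free_group n)" if "x \<in> carrier (free_group n)" for x
    using hom that by (auto simp: hom_def)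
  have clo': "transvection n k (inv_word u) (inv_word v) x \<in> carrier (free_group n)"
    if "x \<in> carrier (free_group n)" for x
    using transvection_hom[OF u' v'] that by (auto simp: hom_def)
  have "bij_betw ?\<phi> (carrier (free_group n)) (carrier (free_group n))"
    using transvection_inverse[OF u v] transvection_inverse[OF u' v'] clo clo'
    by (intro bij_betw_byWitness[where f' = "transvection n k (inv_word u) (inv_word v)"]) auto
  then have "restrict ?\<phi> (carrier (free_group n)) \<in> auto (free_group n)"
    using hom by (auto simp: auto_def Bij_def hom_def Pi_iff)
  moreover have "subgroup {g \<in> carrier (free_group n).
      ?\<phi> g \<otimes>\<^bsub>free_group n\<^esub> inv\<^bsub>free_group n\<^esub> g \<in> lcs (free_group n) d} (free_group n)"
    by (rule F.subgroup_trivial_mod_normal[OF L.normal_axioms hom])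
  then have "{g \<in> carrier (free_group n).
      ?\<phi> g \<otimes>\<^bsub>free_group n\<^esub> inv\<^bsub>free_group n\<^esub> g \<in> lcs (free_group n) d} = carrier (free_group n)"
  proof (rule free_group_subgroup_eq)
    fix i assume i: "i < n"
    have "?\<phi> (gen i) \<otimes>\<^bsub>free_group n\<^esub> inv\<^bsub>free_group n\<^esub> gen i \<in> lcs (free_group n) d"
    proof (cases "i = k")
      case True
      then show ?thesis using c by (simp only: transvection_gen)
    next
      case False
      then have "?\<phi> (gen i) = gen i" using i by (simp add: transvection_fixes gen_in_carrier)
      then show ?thesis using i by (simp add: gen_in_carrier)
    qed
    then show "gen i \<in> {g \<in> carrier (free_group n).
        ?\<phi> g \<otimes>\<^bsub>free_group n\<^esub> inv\<^bsub>free_group n\<^esub> g \<in> lcs (free_group n) d}"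
      using i by (simp add: gen_in_carrier)
  qed
  ultimately show ?thesis unfolding IA_def gamma_def by auto
qed

end

section \<open>An element with nonzero trace\<close>

text \<open>The left-normed commutator [x_0, x_1, ..., x_j] of weight j + 1.\<close>

primrec left_commutator :: "nat \<Rightarrow> nat \<Rightarrow> letter list" where
  "left_commutator n 0 = gen 0"
| "left_commutator n (Suc j) = commutator (free_group n) (left_commutator n j) (gen (Suc j))"

lemma left_commutator_lcs: "j < n \<Longrightarrow> left_commutator n j \<in> lcs (free_group n) j"
proof (induction j)
  case (Suc j)
  then have "left_commutator n j \<in> lcs (free_group n) j" "gen (Suc j) \<in> carrier (free_group n)"
    by (simp_all add: gen_in_carrier)
  then show ?case unfolding lcs.simps(2) left_commutator.simps by (blast intro: generate.incl)
qed (simp add: gen_in_carrier)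

lemma (in subgroup) commutator_closed:
  "group G \<Longrightarrow> x \<in> H \<Longrightarrow> y \<in> H \<Longrightarrow> commutator G x y \<in> H"
  by (simp add: commutator_def)

lemma left_commutator_closed:
  assumes "k \<le> n" "j < k"
  shows "left_commutator n j \<in> carrier (free_group k)"
proof -
  interpret Fk: subgroup "carrier (free_group k)" "free_group n"
    by (rule subgroup_free_group[OF assms(1)])
  show ?thesis
    using assms(2)
    by (induction j) (simp_all add: gen_in_carrier Fk.commutator_closed group_free_group)
qed

text \<open>A pure power of one form takes equal values on the two products that make up a Lie
  bracket.\<close>

lemma magnus_commutator_replicate:
  assumes "x \<in> lcs (free_group n) j" "g \<in> carrier (free_group n)"
  shows "magnus (commutator (free_group n) x g) (replicate (Suc (Suc j)) S) = 0"
proof -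
  interpret series_hom "free_group n" magnus by (rule series_hom_magnus_id)
  have "drop (Suc j) (replicate (Suc (Suc j)) S) = [S]"
    by (simp only: drop_replicate) simp
  moreover have "take (Suc j) (replicate (Suc (Suc j)) S) = drop 1 (replicate (Suc (Suc j)) S)"
    by (simp only: drop_replicate take_replicate) simp
  moreover have "take 1 (replicate (Suc (Suc j)) S) = [S]"
    by simp
  ultimately show ?thesis
    unfolding N_commutator_lcs[OF assms length_replicate] by (simp only: mult.commute diff_self)
qed

lemma drop_Cons_replicate: "drop (Suc j) (a # replicate (Suc j) S) = [S]"
  by (simp only: drop_Suc_Cons drop_replicate) simp

lemma take_Cons_replicate: "take (Suc j) (a # replicate (Suc j) S) = a # replicate j S"
  by (simp only: take_Suc_Cons take_replicate) simp

text \<open>In each bracket the subtracted product begins with the new generator, which the form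
  \<open>{0}\<close> kills; only the monomial x_0 x_1 ... x_j survives.\<close>

lemma magnus_left_commutator:
  "j < n \<Longrightarrow> magnus (left_commutator n j) ({0} # replicate j S) = of_bool ({1..j} \<subseteq> S)"
proof (induction j)
  case (Suc j)
  interpret series_hom "free_group n" magnus by (rule series_hom_magnus_id)
  have lc: "left_commutator n j \<in> lcs (free_group n) j" and g: "gen (Suc j) \<in> carrier (free_group n)"
    using Suc.prems by (simp_all add: left_commutator_lcs gen_in_carrier)
  have len: "length ({0} # replicate (Suc j) S) = Suc (Suc j)" by simp
  have "magnus (left_commutator n (Suc j)) ({0} # replicate (Suc j) S)
      = of_bool ({1..j} \<subseteq> S) * of_bool (Suc j \<in> S)"
    unfolding left_commutator.simps N_commutator_lcs[OF lc g len]
      take_Cons_replicate drop_Cons_replicate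
    using Suc by simp
  also have "\<dots> = of_bool ({1..Suc j} \<subseteq> S)"
    by (auto simp: atLeastAtMostSuc_conv)
  finally show ?case .
qed simp

lemma alt_trace_commutator:
  assumes "Suc j < n" "0 < j"
  shows "alt_trace 0 (Suc j) (commutator (free_group n) (left_commutator n j) (gen 0)) = 1"
proof -
  interpret series_hom "free_group n" magnus by (rule series_hom_magnus_id)
  obtain i where i: "j = Suc i" using assms(2) by (cases j) auto
  have lc: "left_commutator n j \<in> lcs (free_group n) j" and g: "gen 0 \<in> carrier (free_group n)"
    using assms by (simp_all add: left_commutator_lcs gen_in_carrier)
  \<comment> \<open>This disposes of the product beginning with the final x_0, which
    \<open>{0}\<close> does not kill. It needs \<open>0 < j\<close>: for \<open>j = 0\<close> there
    is no bracket, only x_0 itself.\<close>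
  have zero: "magnus (left_commutator n j) (replicate (Suc j) S) = 0" for S
    unfolding i left_commutator.simps
    using assms i by (intro magnus_commutator_replicate left_commutator_lcs) (simp_all add: gen_in_carrier)
  have "magnus (commutator (free_group n) (left_commutator n j) (gen 0)) ({0} # replicate (Suc j) S)
      = of_bool (S = {..<Suc j})" if S: "S \<in> Pow {..<Suc j}" for S
  proof -
    have len: "length ({0} # replicate (Suc j) S) = Suc (Suc j)" by simp
    have "{1..j} \<subseteq> S \<and> 0 \<in> S \<longleftrightarrow> S = {..<Suc j}"
    proof -
      have "{..<Suc j} = insert 0 {1..j}" by auto
      then show ?thesis using S by auto
    qed
    moreover have "magnus (commutator (free_group n) (left_commutator n j) (gen 0)) ({0} # replicate (Suc j) S)
        = of_bool ({1..j} \<subseteq> S) * of_bool (0 \<in> S)"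
      unfolding N_commutator_lcs[OF lc g len] take_Cons_replicate drop_Cons_replicate
      using assms zero[of S] by (simp add: magnus_left_commutator del: replicate_Suc)
    ultimately show ?thesis by (simp flip: of_bool_conj)
  qed
  then have "alt_trace 0 (Suc j) (commutator (free_group n) (left_commutator n j) (gen 0))
      = (\<Sum>S\<in>Pow {..<Suc j}. if S = {..<Suc j} then 1 else 0)"
    unfolding alt_trace_def by (intro sum.cong refl) (simp only: of_bool_def)
  also have "\<dots> = 1"
    by (subst sum.delta) (auto simp: finite_Pow_iff)
  finally show ?thesis .
qed

text \<open>Here \<open>{1}\<close> kills x_0 x_1 and selects x_1 x_0, and of the two subsets of
  \<open>{..<1}\<close> only \<open>{0}\<close> contributes.\<close>

lemma alt_trace_commutator_gens:
  assumes "1 < n"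
  shows "alt_trace 1 1 (commutator (free_group n) (gen 0) (gen 1)) = 1"
proof -
  interpret series_hom "free_group n" magnus by (rule series_hom_magnus_id)
  have g: "gen 0 \<in> lcs (free_group n) 0" "gen 1 \<in> carrier (free_group n)"
    using assms by (simp_all add: gen_in_carrier)
  have "magnus (commutator (free_group n) (gen 0) (gen 1)) [{1}, S] = - of_bool (0 \<in> S)" for S
    using N_commutator_lcs[OF g, of "[{1}, S]"] by (simp del: uminus_bit_def)
  moreover have "Pow {..<1} = {{}, {0 :: nat}}" by (auto simp: lessThan_Suc)
  ultimately show ?thesis by (simp add: alt_trace_def)
qed

lemma exists_IA_nonzero_trace:
  assumes "1 \<le> k" "k < n"
  obtains \<phi> a where "\<phi> \<in> IA n k"
    "alt_trace a k (\<phi> (gen k) \<otimes>\<^bsub>free_group n\<^esub> inv\<^bsub>free_group n\<^esub> gen k) = 1"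
proof -
  interpret F: group "free_group n" by (rule group_free_group)
  have gk: "gen k \<in> carrier (free_group n)" using assms by (simp add: gen_in_carrier)
  note conclude = that
  have *: thesis if u: "u \<in> carrier (free_group k)" and v: "v \<in> carrier (free_group k)"
    and lcs: "u \<otimes>\<^bsub>free_group n\<^esub> (gen k \<otimes>\<^bsub>free_group n\<^esub> v) \<otimes>\<^bsub>free_group n\<^esub> inv\<^bsub>free_group n\<^esub> gen k
      \<in> lcs (free_group n) k"
    and tr: "alt_trace a k (u \<otimes>\<^bsub>free_group n\<^esub> (gen k \<otimes>\<^bsub>free_group n\<^esub> v)
      \<otimes>\<^bsub>free_group n\<^esub> inv\<^bsub>free_group n\<^esub> gen k) = 1" for u v a
    using transvection_in_IA[OF assms(2) u v lcs] tr gk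
    by (intro conclude[of "restrict (transvection n k u v) (carrier (free_group n))" a])
      (simp_all only: restrict_apply' transvection_gen[OF assms(2)])
  show thesis
  proof (cases "k = 1")
    case True
    have g0: "gen 0 \<in> carrier (free_group k)" using True by (simp add: gen_in_carrier)
    have g0F: "gen 0 \<in> carrier (free_group n)" using assms by (simp add: gen_in_carrier)
    \<comment> \<open>The commutator of x_0 and x_1 involves x_1, so it is not an admissible
      multiplier; it arises instead as the displacement of x_1 under conjugation by x_0.\<close>
    have eq: "gen 0 \<otimes>\<^bsub>free_group n\<^esub> (gen k \<otimes>\<^bsub>free_group n\<^esub> inv_word (gen 0)) \<otimes>\<^bsub>free_group n\<^esub>
        inv\<^bsub>free_group n\<^esub> gen k = commutator (free_group n) (gen 0) (gen 1)"
      using True gk g0F by (simp add: commutator_def F.m_assoc flip: inv_free_group[OF g0F])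
    have "commutator (free_group n) (gen 0) (gen 1) \<in> lcs (free_group n) 1"
      using left_commutator_lcs[of 1 n] assms by simp
    then show thesis
      using *[OF g0 inv_word_closed[OF g0], of 1] alt_trace_commutator_gens[of n] assms True
      unfolding eq by simp
  next
    case False
    then obtain j where j: "k = Suc j" "0 < j" using assms(1) by (cases k) auto
    \<comment> \<open>The last entry repeats x_0 so that the word avoids x_k and still has weight k
      + 1.\<close>
    let ?u = "commutator (free_group n) (left_commutator n j) (gen 0)"
    interpret Fk: subgroup "carrier (free_group k)" "free_group n"
      using assms by (intro subgroup_free_group) simp
    have u: "?u \<in> carrier (free_group k)"
      using assms j by (intro Fk.commutator_closed group_free_group left_commutator_closed)
        (simp_all add: gen_in_carrier)
    have "left_commutator n j \<in> lcs (free_group n) j" "gen 0 \<in> carrier (free_group n)"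
      using assms j by (auto intro: left_commutator_lcs simp: gen_in_carrier)
    then have lcs: "?u \<in> lcs (free_group n) k"
      unfolding j lcs.simps(2) by (blast intro: generate.incl)
    have eq: "?u \<otimes>\<^bsub>free_group n\<^esub> (gen k \<otimes>\<^bsub>free_group n\<^esub> \<one>\<^bsub>free_group n\<^esub>) \<otimes>\<^bsub>free_group n\<^esub>
        inv\<^bsub>free_group n\<^esub> gen k = ?u"
      using gk Fk.mem_carrier[OF u] by (simp add: F.m_assoc)
    show thesis
      using *[OF u Fk.one_closed, of 0] lcs alt_trace_commutator[of j n] assms j
      unfolding eq by simp
  qed
qed

theorem theoremD:
  fixes n k :: nat
  assumes "1 \<le> k" and "k < n"
  shows "\<not> (\<exists>Gens. Gens \<subseteq> IA n k \<and>
              (\<forall>\<phi> \<in> Gens. \<exists>A B. free_splitting (free_group n) A B \<and>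
                               subgroup_rank (free_group n) A < k \<and>
                               supported_on \<phi> A B) \<and>
              generate (AutoGroup (free_group n)) Gens = IA n k)"
proof
  interpret F: group "free_group n" by (rule group_free_group)
  assume "\<exists>Gens. Gens \<subseteq> IA n k \<and>
              (\<forall>\<phi> \<in> Gens. \<exists>A B. free_splitting (free_group n) A B \<and>
                               subgroup_rank (free_group n) A < k \<and>
                               supported_on \<phi> A B) \<and>
              generate (AutoGroup (free_group n)) Gens = IA n k"
  then obtain Gens where Gens: "Gens \<subseteq> IA n k"
    "\<And>\<phi>. \<phi> \<in> Gens \<Longrightarrow> \<exists>A B. free_splitting (free_group n) A B \<and>
       subgroup_rank (free_group n) A < k \<and> supported_on \<phi> A B"
    "generate (AutoGroup (free_group n)) Gens = IA n k"
    by blast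
  obtain \<phi> a where \<phi>: "\<phi> \<in> IA n k"
    "alt_trace a k (\<phi> (gen k) \<otimes>\<^bsub>free_group n\<^esub> inv\<^bsub>free_group n\<^esub> gen k) = 1"
    by (rule exists_IA_nonzero_trace[OF assms])
  \<comment> \<open>Trivial action modulo \<open>trace_kernel\<close> spreads from the generators to
    \<open>\<phi>\<close>, contradicting its trace 1.\<close>
  have "\<phi> (gen k) \<otimes>\<^bsub>free_group n\<^esub> inv\<^bsub>free_group n\<^esub> gen k \<in> trace_kernel n a k"
  proof (rule F.generate_AutoGroup_trivial_mod_normal[OF trace_kernel_normal])
    fix \<psi> assume \<psi>: "\<psi> \<in> Gens"
    then show "\<psi> \<in> auto (free_group n)" using Gens(1) by (auto simp: IA_def)
    fix g assume "g \<in> carrier (free_group n)"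
    then show "\<psi> g \<otimes>\<^bsub>free_group n\<^esub> inv\<^bsub>free_group n\<^esub> g \<in> trace_kernel n a k"
      using Gens(1) Gens(2)[OF \<psi>] \<psi> supported_trivial_mod_trace_kernel by blast
  next
    show "\<phi> \<in> generate (AutoGroup (free_group n)) Gens" using Gens(3) \<phi>(1) by simp
    show "gen k \<in> carrier (free_group n)" using assms by (simp add: gen_in_carrier)
  qed
  then show False using \<phi>(2) by (simp add: trace_kernel_def)
qed

end
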